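(* Let $f:\mathbb{D}^2\to\mathbb{D}$ be a holomorphic function with $f(0,0)=0$. Then $f$ is everywhere infinitesimally extremal if and only if there exist $\mu,a,b\in\mathbb{C}$ with $|\mu|=1$ and $|a|+|b|=1$ such that $$f(z,w)=\mu\,\frac{az+bw-zw}{1-\bar{b}z-\bar{a}w}\qquad\text{for all }(z,w)\in\mathbb{D}^2.$$
   Context: $\mathbb{D}=\{\zeta\in\mathbb{C}:|\zeta|<1\}$ is the open unit disk and $\mathbb{D}^2=\mathbb{D}\times\mathbb{D}$ is the bidisk. A holomorphic function $f:\mathbb{D}^2\to\mathbb{D}$ is called everywhere infinitesimally extremal if $$(1-|z|^2)\left|\frac{\partial f}{\partial z}(z,w)\right|+(1-|w|^2)\left|\frac{\partial f}{\partial w}(z,w)\right|=1-|f(z,w)|^2$$ for every $(z,w)\in\mathbb{D}^2$. *)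

theory Defs
  imports "HOL-Complex_Analysis.Complex_Analysis"
begin

abbreviation unit_disk :: "complex set" ("\<D>") where
  "\<D> \<equiv> ball 0 1"

abbreviation bidisk :: "(complex \<times> complex) set" ("\<D>\<^sup>2") where
  "\<D>\<^sup>2 \<equiv> \<D> \<times> \<D>"

text \<open>Holomorphy in two complex variables: at every point of \<open>S\<close> there is a Frechet derivative,
  and it is complex-linear.\<close>

definition holomorphic2_on :: "(complex \<times> complex \<Rightarrow> complex) \<Rightarrow> (complex \<times> complex) set \<Rightarrow> bool"
    (infixl "holomorphic2'_on" 50) where
  "f holomorphic2_on S \<longleftrightarrow>
     (\<forall>p\<in>S. \<exists>A B. (f has_derivative (\<lambda>(h, k). A * h + B * k)) (at p within S))"

definition partial_z :: "(complex \<times> complex \<Rightarrow> complex) \<Rightarrow> complex \<times> complex \<Rightarrow> complex" where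
  "partial_z f = (\<lambda>(z, w). deriv (\<lambda>\<zeta>. f (\<zeta>, w)) z)"

definition partial_w :: "(complex \<times> complex \<Rightarrow> complex) \<Rightarrow> complex \<times> complex \<Rightarrow> complex" where
  "partial_w f = (\<lambda>(z, w). deriv (\<lambda>\<zeta>. f (z, \<zeta>)) w)"

definition everywhere_infinitesimally_extremal :: "(complex \<times> complex \<Rightarrow> complex) \<Rightarrow> bool" where
  "everywhere_infinitesimally_extremal f \<longleftrightarrow>
     (\<forall>(z, w) \<in> \<D>\<^sup>2.
        (1 - (cmod z)\<^sup>2) * cmod (partial_z f (z, w)) + (1 - (cmod w)\<^sup>2) * cmod (partial_w f (z, w))
          = 1 - (cmod (f (z, w)))\<^sup>2)"

end

theory Submission imports Defs "HOL-Real_Asymp.Real_Asymp" begin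

text \<open>
  After rotating the variables, \<open>f\<^sub>z(0,0) = t\<close> and \<open>f\<^sub>w(0,0) = 1 - t\<close> with \<open>0 \<le> t \<le> 1\<close>. For \<open>|\<psi>| = 1\<close> write
  \<open>f(x, x\<psi>) = x h(x)\<close> with \<open>|h| \<le> 1\<close> on the disk. The Schwarz-Pick inequality
  \<open>|h'(0)| \<le> 1 - |h(0)|\<^sup>2 = t(1-t)|1-\<psi>|\<^sup>2\<close> forces the quadratic part of \<open>f\<close> to be \<open>A(z-w)\<^sup>2\<close> with \<open>|A| \<le> t(1-t)\<close>.
  The second-order terms of the extremality equation along \<open>w = 0\<close>, averaged over the argument of \<open>z\<close>,
  give \<open>|A| = t(1-t)\<close>. Hence Schwarz-Pick is an equality for every \<open>\<psi>\<close>, so \<open>h\<close> is an explicit Moebius map;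
  this determines \<open>f\<close> on \<open>|z| = |w|\<close> and therefore everywhere. If \<open>t\<close> is \<open>0\<close> or \<open>1\<close>, then \<open>|h(0)| = 1\<close> and \<open>h\<close> is constant.
\<close>

section \<open>Schwarz-Pick at the origin\<close>

text \<open>This is the Schwarz lemma for \<open>(k - k 0) / (2 * M + 1)\<close>; the added 1 makes
  its modulus strictly less than 1 and the divisor positive even when \<open>M = 0\<close>. The
  constant depends on \<open>M\<close> alone, so the bounds are uniform over a family with a common
  bound.\<close>

lemma schwarz_slope_bound:
  assumes k: "k holomorphic_on \<D>" and M: "\<And>w. w \<in> \<D> \<Longrightarrow> cmod (k w) \<le> M"
  shows "\<And>w. w \<in> \<D> \<Longrightarrow> cmod (k w - k 0) \<le> (2 * M + 1) * cmod w"
    and "cmod (deriv k 0) \<le> 2 * M + 1"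
proof -
  define N where "N = 2 * M + 1"
  define u where "u = (\<lambda>w. (k w - k 0) / of_real N)"
  have "cmod (k 0) \<le> M"
    using M[of 0] by simp
  then have N: "N > 0"
    unfolding N_def using norm_ge_zero[of "k 0"] by linarith
  have hol: "u holomorphic_on \<D>"
    unfolding u_def using k N by (intro holomorphic_intros) auto
  have lt: "cmod (u w) < 1" if "cmod w < 1" for w
  proof -
    have "cmod (k w - k 0) \<le> cmod (k w) + cmod (k 0)"
      by (rule norm_triangle_ineq4)
    also have "\<dots> < N"
      using M[of w] M[of 0] that by (simp add: N_def)
    finally show ?thesis
      using N by (simp add: u_def norm_divide)
  qed
  have u0: "u 0 = 0"
    by (simp add: u_def)
  show "cmod (k w - k 0) \<le> (2 * M + 1) * cmod w" if "w \<in> \<D>" for w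
    using Schwarz_Lemma(1)[OF hol u0 lt, of w] that N unfolding N_def[symmetric]
    by (simp add: u_def norm_divide pos_divide_le_eq mult.commute)
  have "(k has_field_derivative deriv k 0) (at 0)"
    by (rule holomorphic_derivI[OF k]) auto
  then have "(u has_field_derivative deriv k 0 / of_real N) (at 0)"
    unfolding u_def using N by (auto intro!: derivative_eq_intros)
  then have "deriv u 0 = deriv k 0 / of_real N"
    by (rule DERIV_imp_deriv)
  then show "cmod (deriv k 0) \<le> 2 * M + 1"
    using Schwarz_Lemma(2)[OF hol u0 lt, of 0] N unfolding N_def[symmetric]
    by (simp add: norm_divide pos_divide_le_eq)
qed

lemma schur_strict:
  assumes h: "h holomorphic_on \<D>" and le: "\<And>x. x \<in> \<D> \<Longrightarrow> cmod (h x) \<le> 1"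
    and h0: "cmod (h 0) < 1" and x: "x \<in> \<D>"
  shows "cmod (h x) < 1"
proof (rule ccontr)
  assume "\<not> cmod (h x) < 1"
  then have 1: "cmod (h x) = 1"
    using le[OF x] by simp
  have "h constant_on \<D>"
    by (rule maximum_modulus_principle[OF h, of \<D> x]) (use x le 1 in auto)
  then have "h x = h 0"
    using x unfolding constant_on_def by fastforce
  then show False
    using 1 h0 by simp
qed

lemma schur_unimodular_constant:
  assumes h: "h holomorphic_on \<D>" and le: "\<And>x. x \<in> \<D> \<Longrightarrow> cmod (h x) \<le> 1"
    and h0: "cmod (h 0) = 1" and x: "x \<in> \<D>"
  shows "h x = h 0"
proof -
  have "h constant_on \<D>"
    by (rule maximum_modulus_principle[OF h, of \<D> 0]) (use le h0 in auto)
  then show ?thesis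
    using x unfolding constant_on_def by fastforce
qed

text \<open>The disk automorphism taking \<open>h 0\<close> to 0 is composed with \<open>h\<close>,
  and the Schwarz lemma is applied to the result \<open>k\<close>. In the equality case
  \<open>k\<close> is a rotation, and solving for \<open>h x\<close> gives the second claim, cleared
  of denominators.\<close>

lemma schwarz_pick_origin:
  fixes h :: "complex \<Rightarrow> complex"
  assumes h: "h holomorphic_on \<D>" and le: "\<And>x. x \<in> \<D> \<Longrightarrow> cmod (h x) \<le> 1"
    and h0: "cmod (h 0) < 1"
  shows "cmod (deriv h 0) \<le> 1 - (cmod (h 0))\<^sup>2"
    and "\<And>x. cmod (deriv h 0) = 1 - (cmod (h 0))\<^sup>2 \<Longrightarrow> x \<in> \<D> \<Longrightarrow>
           h x * (1 - (cmod (h 0))\<^sup>2 + cnj (h 0) * deriv h 0 * x)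
             = h 0 * (1 - (cmod (h 0))\<^sup>2) + deriv h 0 * x"
proof -
  define s where "s = 1 - (cmod (h 0))\<^sup>2"
  have s: "s > 0"
    using h0 by (simp add: s_def power_less_one_iff abs_square_less_1)
  have s': "1 - h 0 * cnj (h 0) = of_real s"
    using complex_norm_square[of "h 0"] by (simp add: s_def)
  define k where "k = (\<lambda>x. (h x - h 0) / (1 - cnj (h 0) * h x))"
  have lt: "cmod (h x) < 1" if "x \<in> \<D>" for x
    using schur_strict[OF h le h0 that] .
  have ne: "1 - cnj (h 0) * h x \<noteq> 0" if "x \<in> \<D>" for x
  proof
    assume "1 - cnj (h 0) * h x = 0"
    then have "cmod (h 0) * cmod (h x) = 1"
      by (metis complex_mod_cnj eq_iff_diff_eq_0 norm_mult norm_one)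
    moreover have "cmod (h 0) * cmod (h x) < 1"
      using h0 lt[OF that] by (metis mult_strict_mono' mult_1_right norm_ge_zero)
    ultimately show False by simp
  qed
  have hol: "k holomorphic_on \<D>"
    unfolding k_def using h ne by (intro holomorphic_intros) auto
  have k0: "k 0 = 0"
    by (simp add: k_def)
  have klt: "cmod (k x) < 1" if "cmod x < 1" for x
  proof -
    have x: "x \<in> \<D>" using that by simp
    have "(cmod (1 - cnj (h 0) * h x))\<^sup>2 - (cmod (h x - h 0))\<^sup>2
            = (1 - (cmod (h 0))\<^sup>2) * (1 - (cmod (h x))\<^sup>2)"
      by (simp add: cmod_power2) (simp add: power2_eq_square algebra_simps)
    also have "\<dots> > 0"
      using h0 lt[OF x] by (simp add: abs_square_less_1)
    finally have "cmod (h x - h 0) < cmod (1 - cnj (h 0) * h x)"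
      by (simp add: power2_less_imp_less)
    then show ?thesis
      using ne[OF x] by (simp add: k_def norm_divide)
  qed
  have dh: "(h has_field_derivative deriv h 0) (at 0)"
    by (rule holomorphic_derivI[OF h]) auto
  have "(k has_field_derivative deriv h 0 / of_real s) (at 0)"
    unfolding k_def
    by (rule derivative_eq_intros dh refl)+
       (use s s' in \<open>simp_all add: mult.commute\<close>)
  then have dk: "deriv k 0 = deriv h 0 / of_real s"
    by (rule DERIV_imp_deriv)
  show "cmod (deriv h 0) \<le> 1 - (cmod (h 0))\<^sup>2"
    using Schwarz_Lemma(2)[OF hol k0 klt, of 0] s
    by (simp add: dk norm_divide s_def[symmetric] field_simps)
  fix x assume eq: "cmod (deriv h 0) = 1 - (cmod (h 0))\<^sup>2" and x: "x \<in> \<D>"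
  have "cmod (deriv k 0) = 1"
    using eq s by (simp add: dk norm_divide s_def[symmetric])
  then obtain \<alpha> where \<alpha>: "\<And>z. cmod z < 1 \<Longrightarrow> k z = \<alpha> * z"
    using Schwarz_Lemma(3)[OF hol k0 klt, of 0] by auto
  have "((\<lambda>z. \<alpha> * z) has_field_derivative \<alpha>) (at 0)"
    by (auto intro!: derivative_eq_intros)
  then have "(k has_field_derivative \<alpha>) (at 0)"
    by (rule has_field_derivative_transform_within_open[where S=\<D>]) (use \<alpha> in auto)
  then have "\<alpha> = deriv h 0 / of_real s"
    using dk DERIV_imp_deriv by force
  then have "k x * of_real s = deriv h 0 * x"
    using \<alpha>[of x] x s by simp
  then have e: "(h x - h 0) * of_real s = deriv h 0 * x * (1 - cnj (h 0) * h x)"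
    using ne[OF x] by (simp add: k_def field_simps)
  have sc: "1 - (of_real (cmod (h 0)))\<^sup>2 = (of_real s :: complex)"
    by (simp add: s_def)
  show "h x * (1 - (cmod (h 0))\<^sup>2 + cnj (h 0) * deriv h 0 * x)
             = h 0 * (1 - (cmod (h 0))\<^sup>2) + deriv h 0 * x"
    by (simp add: sc) (use e in \<open>simp add: algebra_simps\<close>)
qed

section \<open>Second-order expansion of slices\<close>

definition separately_holomorphic_bounded :: "(complex \<Rightarrow> complex \<Rightarrow> complex) \<Rightarrow> bool" where
  "separately_holomorphic_bounded F \<longleftrightarrow>
     (\<forall>w\<in>\<D>. (\<lambda>z. F z w) holomorphic_on \<D>) \<and> (\<forall>z\<in>\<D>. F z holomorphic_on \<D>) \<and>
     (\<exists>M. \<forall>z\<in>\<D>. \<forall>w\<in>\<D>. cmod (F z w) \<le> M)"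

text \<open>The value at \<open>w = 0\<close> removes the singularity, so
  \<open>w_quotient F z 0\<close> is the first Taylor coefficient of \<open>F z\<close> at 0, and
  iterating the operator produces the higher ones. This takes the place of a power series in two
  variables.\<close>

definition w_quotient :: "(complex \<Rightarrow> complex \<Rightarrow> complex) \<Rightarrow> complex \<Rightarrow> complex \<Rightarrow> complex" where
  "w_quotient F z w = (if w = 0 then deriv (F z) 0 else (F z w - F z 0) / w)"

lemma w_quotient_mult: "F z w = F z 0 + w * w_quotient F z w"
  by (simp add: w_quotient_def)

text \<open>The slope bound gives boundedness, and the removable singularity gives holomorphy in
  \<open>w\<close>. The delicate point is holomorphy in \<open>z\<close> at \<open>w = 0\<close>: a
  second use of the slope bound makes \<open>w_quotient F z w\<close> tend to
  \<open>w_quotient F z 0\<close> at a rate uniform in \<open>z\<close>, so the limit is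
  holomorphic.\<close>

lemma separately_holomorphic_bounded_w_quotient:
  assumes "separately_holomorphic_bounded F"
  shows "separately_holomorphic_bounded (w_quotient F)"
proof -
  obtain M where Fz: "\<And>w. w \<in> \<D> \<Longrightarrow> (\<lambda>z. F z w) holomorphic_on \<D>"
    and Fw: "\<And>z. z \<in> \<D> \<Longrightarrow> F z holomorphic_on \<D>"
    and M: "\<And>z w. z \<in> \<D> \<Longrightarrow> w \<in> \<D> \<Longrightarrow> cmod (F z w) \<le> M"
    using assms unfolding separately_holomorphic_bounded_def by blast
  define N where "N = 2 * M + 1"
  have Qw: "w_quotient F z holomorphic_on \<D>" if "z \<in> \<D>" for z
    using pole_lemma[OF Fw[OF that], of 0] by (simp add: w_quotient_def[abs_def] cong: if_cong)
  have N: "cmod (w_quotient F z w) \<le> N" if z: "z \<in> \<D>" and w: "w \<in> \<D>" for z w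
    using schwarz_slope_bound[OF Fw[OF z] M[OF z]] w
    by (auto simp: w_quotient_def N_def norm_divide divide_simps)
  have Lip: "cmod (w_quotient F z w - w_quotient F z 0) \<le> (2 * N + 1) * cmod w"
    if z: "z \<in> \<D>" and w: "w \<in> \<D>" for z w
    using schwarz_slope_bound(1)[OF Qw[OF z] N[OF z]] w by auto
  have Qz: "(\<lambda>z. w_quotient F z w) holomorphic_on \<D>" if "w \<in> \<D>" "w \<noteq> 0" for w
  proof -
    have "(\<lambda>z. (F z w - F z 0) / w) holomorphic_on \<D>"
      using Fz[of w] Fz[of 0] that by (intro holomorphic_intros) auto
    then show ?thesis
      using that by (simp add: w_quotient_def)
  qed
  have Qz0: "(\<lambda>z. w_quotient F z 0) holomorphic_on \<D>"
  \<comment> \<open>The points \<open>1 / (n + 2)\<close> tend to 0 while staying nonzero and inside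
    the open disk from \<open>n = 0\<close> on.\<close>
  proof (rule holomorphic_uniform_sequence[where f = "\<lambda>n z. w_quotient F z (of_real (1 / (real n + 2)))"])
    show "(\<lambda>z. w_quotient F z (of_real (1 / (real n + 2)))) holomorphic_on \<D>" for n
      by (rule Qz) (auto simp: norm_divide simp del: of_real_divide)
    fix x :: complex assume "x \<in> \<D>"
    then obtain d where d: "d > 0" "cball x d \<subseteq> \<D>"
      using open_contains_cball[of \<D>] open_ball by blast
    have "uniform_limit (cball x d) (\<lambda>n z. w_quotient F z (of_real (1 / (real n + 2))))
            (\<lambda>z. w_quotient F z 0) sequentially"
    proof (rule uniform_limitI)
      fix e :: real assume e: "e > 0"
      have "(\<lambda>n. (2 * N + 1) * (1 / (real n + 2))) \<longlonglongrightarrow> 0"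
        by real_asymp
      then have "\<forall>\<^sub>F n in sequentially. (2 * N + 1) * (1 / (real n + 2)) < e"
        using e by (rule order_tendstoD)
      then show "\<forall>\<^sub>F n in sequentially. \<forall>y\<in>cball x d.
          dist (w_quotient F y (of_real (1 / (real n + 2)))) (w_quotient F y 0) < e"
      proof eventually_elim
        case (elim n)
        show ?case
        proof
          fix y assume "y \<in> cball x d"
          then have y: "y \<in> \<D>" using d by blast
          have "dist (w_quotient F y (of_real (1 / (real n + 2)))) (w_quotient F y 0)
                 \<le> (2 * N + 1) * cmod (of_real (1 / (real n + 2)))"
            unfolding dist_norm by (rule Lip[OF y]) (auto simp del: of_real_divide)
          also have "\<dots> < e"
            using elim by (simp del: of_real_divide)
          finally show "dist (w_quotient F y (of_real (1 / (real n + 2)))) (w_quotient F y 0) < e" .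
        qed
      qed
    qed
    with d show "\<exists>d>0. cball x d \<subseteq> \<D> \<and> uniform_limit (cball x d)
        (\<lambda>n z. w_quotient F z (of_real (1 / (real n + 2)))) (\<lambda>z. w_quotient F z 0) sequentially"
      by blast
  qed auto
  show ?thesis
    unfolding separately_holomorphic_bounded_def using Qz Qz0 Qw N by metis
qed

text \<open>In \<open>slice_quotient\<close> the remainder \<open>q\<close> is an iterated quotient
  evaluated along \<open>w = x * \<psi>\<close>, where separate holomorphy gives no immediate
  regularity in \<open>x\<close>; a bound is what is at hand.\<close>

lemma DERIV_square_times_bounded:
  fixes q :: "complex \<Rightarrow> complex"
  assumes "\<And>x. x \<in> \<D> \<Longrightarrow> cmod (q x) \<le> K"
  shows "((\<lambda>x. x\<^sup>2 * q x) has_field_derivative 0) (at 0)"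
proof -
  have "((\<lambda>x. x * q x) \<longlongrightarrow> 0) (at 0)"
  proof (rule Lim_null_comparison)
    show "\<forall>\<^sub>F x in at 0. cmod (x * q x) \<le> cmod x * K"
      unfolding eventually_at
      by (rule exI[of _ 1]) (auto simp: norm_mult intro!: mult_left_mono assms)
    show "((\<lambda>x::complex. cmod x * K) \<longlongrightarrow> 0) (at 0)"
      by (auto intro!: tendsto_eq_intros)
  qed
  then show ?thesis
    unfolding has_field_derivative_iff
    by (rule Lim_transform_eventually) (auto simp: eventually_at_filter power2_eq_square)
qed

section \<open>Four-point averages of squared moduli\<close>

text \<open>Summing over four equally spaced arguments cancels the terms of order \<open>h\<close> and \<open>h\<^sup>2\<close>, leaving only
  the rotation-invariant part of order \<open>|h|\<^sup>2\<close>.\<close>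

definition quad_sum :: "(complex \<Rightarrow> real) \<Rightarrow> real \<Rightarrow> real" where
  "quad_sum u r = u (of_real r) + u (\<i> * of_real r) + u (- of_real r) + u (- \<i> * of_real r)"

text \<open>Write \<open>P h = p0 + p1 * h + h\<^sup>2 * q h\<close>. The affine part supplies the
  limit. The interaction of \<open>p0\<close> with the quadratic term cancels because the squares of
  1, i, -1, -i sum to 0, and the rest is of higher order.\<close>

lemma quad_sum_norm_square_tendsto:
  assumes P: "P holomorphic_on ball 0 e" and e: "e > 0"
  shows "((\<lambda>r. (quad_sum (\<lambda>h. (cmod (P h))\<^sup>2) r - 4 * (cmod (P 0))\<^sup>2) / r\<^sup>2)
            \<longlongrightarrow> 4 * (cmod (deriv P 0))\<^sup>2) (at_right 0)"
proof -
  define P1 where "P1 = (\<lambda>z. if z = 0 then deriv P 0 else (P z - P 0) / z)"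
  define q where "q = (\<lambda>z. if z = 0 then deriv P1 0 else (P1 z - P1 0) / z)"
  define p0 p1 where "p0 = P 0" and "p1 = deriv P 0"
  have P1: "P1 holomorphic_on ball 0 e"
    using pole_lemma[OF P, of 0] e by (simp add: P1_def cong: if_cong)
  have q: "q holomorphic_on ball 0 e"
    using pole_lemma[OF P1, of 0] e by (simp add: q_def cong: if_cong)
  have Pq: "P h = p0 + p1 * h + h\<^sup>2 * q h" for h
    by (auto simp: q_def P1_def p0_def p1_def field_simps power2_eq_square)
  have qc: "isCont q 0"
    using holomorphic_on_imp_continuous_on[OF q] e by (simp add: continuous_on_eq_continuous_at)
  \<comment> \<open>Subtracting the affine part removes the terms of order 0 and 1 along each ray,
    so division by \<open>r\<^sup>2\<close> leaves a finite limit.\<close>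
  have lim: "((\<lambda>r. ((cmod (P (c * of_real r)))\<^sup>2 - (cmod (p0 + p1 * (c * of_real r)))\<^sup>2) / r\<^sup>2)
               \<longlongrightarrow> 2 * Re (cnj p0 * (c\<^sup>2 * q 0))) (at_right 0)" for c
  proof -
    have lr: "((\<lambda>r. c * of_real r) \<longlongrightarrow> 0) (at_right (0::real))"
      by (auto intro!: tendsto_eq_intros)
    have lq: "((\<lambda>r. q (c * of_real r)) \<longlongrightarrow> q 0) (at_right (0::real))"
      by (rule isCont_tendsto_compose[OF qc lr])
    have "((\<lambda>r. 2 * Re (cnj (p0 + p1 * (c * of_real r)) * (c\<^sup>2 * q (c * of_real r)))
              + r\<^sup>2 * (cmod (c\<^sup>2 * q (c * of_real r)))\<^sup>2)
           \<longlongrightarrow> 2 * Re (cnj (p0 + p1 * 0) * (c\<^sup>2 * q 0)) + 0\<^sup>2 * (cmod (c\<^sup>2 * q 0))\<^sup>2) (at_right (0::real))"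
      by (intro tendsto_intros lr lq)
    moreover have "\<forall>\<^sub>F r in at_right 0.
       2 * Re (cnj (p0 + p1 * (c * of_real r)) * (c\<^sup>2 * q (c * of_real r)))
              + r\<^sup>2 * (cmod (c\<^sup>2 * q (c * of_real r)))\<^sup>2
       = ((cmod (P (c * of_real r)))\<^sup>2 - (cmod (p0 + p1 * (c * of_real r)))\<^sup>2) / r\<^sup>2"
    proof -
      have id: "(cmod (a + of_real (r\<^sup>2) * b))\<^sup>2 - (cmod a)\<^sup>2
              = r\<^sup>2 * (2 * Re (cnj a * b) + r\<^sup>2 * (cmod b)\<^sup>2)" for a b :: complex and r :: real
        by (simp add: cmod_power2) (simp add: power2_eq_square algebra_simps)
      have "P (c * of_real r) = p0 + p1 * (c * of_real r) + of_real (r\<^sup>2) * (c\<^sup>2 * q (c * of_real r))" for r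
        unfolding Pq by (simp add: power_mult_distrib)
      then show ?thesis
        unfolding eventually_at_filter by (simp only: id) (auto simp: field_simps)
    qed
    ultimately show ?thesis
      using Lim_transform_eventually by fastforce
  qed
  have "((\<lambda>r. ((cmod (P (1 * of_real r)))\<^sup>2 - (cmod (p0 + p1 * (1 * of_real r)))\<^sup>2) / r\<^sup>2
          + ((cmod (P (\<i> * of_real r)))\<^sup>2 - (cmod (p0 + p1 * (\<i> * of_real r)))\<^sup>2) / r\<^sup>2
          + ((cmod (P (- 1 * of_real r)))\<^sup>2 - (cmod (p0 + p1 * (- 1 * of_real r)))\<^sup>2) / r\<^sup>2
          + ((cmod (P (- \<i> * of_real r)))\<^sup>2 - (cmod (p0 + p1 * (- \<i> * of_real r)))\<^sup>2) / r\<^sup>2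
          + 4 * (cmod p1)\<^sup>2)
     \<longlongrightarrow> 2 * Re (cnj p0 * (1\<^sup>2 * q 0)) + 2 * Re (cnj p0 * (\<i>\<^sup>2 * q 0))
      + 2 * Re (cnj p0 * ((- 1)\<^sup>2 * q 0)) + 2 * Re (cnj p0 * ((- \<i>)\<^sup>2 * q 0))
          + 4 * (cmod p1)\<^sup>2) (at_right 0)"
    by (intro tendsto_add lim tendsto_const)
  moreover have "2 * Re (cnj p0 * (1\<^sup>2 * q 0)) + 2 * Re (cnj p0 * (\<i>\<^sup>2 * q 0))
      + 2 * Re (cnj p0 * ((- 1)\<^sup>2 * q 0)) + 2 * Re (cnj p0 * ((- \<i>)\<^sup>2 * q 0)) = 0"
    by (simp add: power2_eq_square)
  moreover have "\<forall>\<^sub>F r in at_right 0.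
      ((cmod (P (1 * of_real r)))\<^sup>2 - (cmod (p0 + p1 * (1 * of_real r)))\<^sup>2) / r\<^sup>2
          + ((cmod (P (\<i> * of_real r)))\<^sup>2 - (cmod (p0 + p1 * (\<i> * of_real r)))\<^sup>2) / r\<^sup>2
          + ((cmod (P (- 1 * of_real r)))\<^sup>2 - (cmod (p0 + p1 * (- 1 * of_real r)))\<^sup>2) / r\<^sup>2
          + ((cmod (P (- \<i> * of_real r)))\<^sup>2 - (cmod (p0 + p1 * (- \<i> * of_real r)))\<^sup>2) / r\<^sup>2
          + 4 * (cmod p1)\<^sup>2
      = (quad_sum (\<lambda>h. (cmod (P h))\<^sup>2) r - 4 * (cmod (P 0))\<^sup>2) / r\<^sup>2"
  proof -
    have "(cmod (p0 + p1 * (1 * of_real r)))\<^sup>2 + (cmod (p0 + p1 * (\<i> * of_real r)))\<^sup>2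
        + (cmod (p0 + p1 * (- 1 * of_real r)))\<^sup>2 + (cmod (p0 + p1 * (- \<i> * of_real r)))\<^sup>2
        = 4 * (cmod p0)\<^sup>2 + 4 * (cmod p1)\<^sup>2 * r\<^sup>2" for r
      by (simp add: cmod_power2) (simp add: power2_eq_square algebra_simps)
    note id = this
    have "quad_sum (\<lambda>h. (cmod (P h))\<^sup>2) r = (cmod (P (1 * of_real r)))\<^sup>2 + (cmod (P (\<i> * of_real r)))\<^sup>2
       + (cmod (P (- 1 * of_real r)))\<^sup>2 + (cmod (P (- \<i> * of_real r)))\<^sup>2" for r
      by (simp add: quad_sum_def)
    note qs = this
    have "(A1 - B1) / r\<^sup>2 + (A2 - B2) / r\<^sup>2 + (A3 - B3) / r\<^sup>2 + (A4 - B4) / r\<^sup>2 + 4 * (cmod p1)\<^sup>2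
       = ((A1 + A2 + A3 + A4) - 4 * (cmod p0)\<^sup>2) / r\<^sup>2"
      if "r \<noteq> 0" "B1 + B2 + B3 + B4 = 4 * (cmod p0)\<^sup>2 + 4 * (cmod p1)\<^sup>2 * r\<^sup>2" for A1 A2 A3 A4 B1 B2 B3 B4 r :: real
    proof -
      have "(A1 - B1) / r\<^sup>2 + (A2 - B2) / r\<^sup>2 + (A3 - B3) / r\<^sup>2 + (A4 - B4) / r\<^sup>2
          = ((A1 + A2 + A3 + A4) - (B1 + B2 + B3 + B4)) / r\<^sup>2"
        by (simp add: add_divide_distrib diff_divide_distrib)
      then show ?thesis
        using that(1) unfolding that(2) by (simp add: field_simps)
    qed
    note alg = this
    show ?thesis
      unfolding eventually_at_filter qs p0_def[symmetric]
      by (intro always_eventually allI impI, rule alg[OF _ id])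
  qed
  ultimately show ?thesis
    unfolding p1_def[symmetric] by (simp add: Lim_transform_eventually)
qed

section \<open>Holomorphic slices of functions on the bidisk\<close>

lemma holomorphic2_on_compose:
  assumes f: "f holomorphic2_on \<D>\<^sup>2" and S: "open S"
    and u: "u holomorphic_on S" and v: "v holomorphic_on S"
    and uS: "\<And>x. x \<in> S \<Longrightarrow> u x \<in> \<D>" and vS: "\<And>x. x \<in> S \<Longrightarrow> v x \<in> \<D>"
  shows "(\<lambda>x. f (u x, v x)) holomorphic_on S"
proof -
  have "\<exists>D. ((\<lambda>x. f (u x, v x)) has_field_derivative D) (at x)" if x: "x \<in> S" for x
  proof -
    have p: "(u x, v x) \<in> \<D>\<^sup>2"
      using uS[OF x] vS[OF x] by blast
    then obtain A B where "(f has_derivative (\<lambda>(h, k). A * h + B * k)) (at (u x, v x) within \<D>\<^sup>2)"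
      using f unfolding holomorphic2_on_def by blast
    then have df: "(f has_derivative (\<lambda>(h, k). A * h + B * k)) (at (u x, v x))"
      using at_within_open[OF p] by (simp add: open_Times)
    have "(u has_field_derivative deriv u x) (at x)" "(v has_field_derivative deriv v x) (at x)"
      using holomorphic_derivI[OF u S x] holomorphic_derivI[OF v S x] by auto
    then have "((\<lambda>x. (u x, v x)) has_derivative (\<lambda>h. (deriv u x * h, deriv v x * h))) (at x)"
      unfolding has_field_derivative_def by (rule has_derivative_Pair)
    from has_derivative_compose[OF this df]
    have "((\<lambda>x. f (u x, v x)) has_derivative (\<lambda>h. (A * deriv u x + B * deriv v x) * h)) (at x)"
      by (simp add: algebra_simps)
    then show ?thesis
      unfolding has_field_derivative_def by blast
  qed
  then show ?thesis
    using S by (simp add: holomorphic_on_open)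
qed

lemma separately_holomorphic_bounded_curry:
  assumes f: "f holomorphic2_on \<D>\<^sup>2" and fD: "f \<in> \<D>\<^sup>2 \<rightarrow> \<D>"
  shows "separately_holomorphic_bounded (\<lambda>z w. f (z, w))"
proof -
  have "cmod (f (z, w)) \<le> 1" if "z \<in> \<D>" "w \<in> \<D>" for z w
  proof -
    have "f (z, w) \<in> \<D>"
      using fD that by (intro funcset_mem[OF fD]) auto
    then show ?thesis by simp
  qed
  then show ?thesis
    unfolding separately_holomorphic_bounded_def
    by (intro conjI ballI holomorphic2_on_compose[OF f] holomorphic_intros exI[of _ 1]) auto
qed

text \<open>On the axis the partial derivative is \<open>w_quotient\<close> at \<open>w = 0\<close>,
  whose holomorphy in \<open>z\<close> was obtained as a uniform limit.\<close>

lemma holomorphic_partial_w_axis: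
  assumes "f holomorphic2_on \<D>\<^sup>2" and "f \<in> \<D>\<^sup>2 \<rightarrow> \<D>"
  shows "(\<lambda>z. partial_w f (z, 0)) holomorphic_on \<D>"
  using separately_holomorphic_bounded_w_quotient[OF separately_holomorphic_bounded_curry[OF assms]]
  by (auto simp: separately_holomorphic_bounded_def w_quotient_def partial_w_def
      dest!: bspec[of _ _ 0])

text \<open>\<open>A\<close>, the derivative of \<open>partial_w f (z, 0)\<close> at 0, and
  \<open>C\<close> are the coefficients of z^2, zw and w^2 in \<open>f\<close> at the origin; along
  \<open>w = x * \<psi>\<close> they combine to the x^2 coefficient of \<open>x * h x\<close>, which
  is \<open>deriv h 0\<close>. They are fixed before \<open>\<psi>\<close>, so different slices can
  be compared. The bound on \<open>h\<close> is the Schwarz lemma for the slice.\<close>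

lemma slice_quotient:
  assumes f: "f holomorphic2_on \<D>\<^sup>2" and fD: "f \<in> \<D>\<^sup>2 \<rightarrow> \<D>" and f0: "f (0, 0) = 0"
  obtains A C where "deriv (\<lambda>z. partial_z f (z, 0)) 0 = 2 * A"
    and "\<forall>\<psi>. cmod \<psi> = 1 \<longrightarrow> (\<exists>h. h holomorphic_on \<D> \<and>
           (\<forall>x\<in>\<D>. cmod (h x) \<le> 1 \<and> f (x, x * \<psi>) = x * h x) \<and>
           h 0 = partial_z f (0, 0) + partial_w f (0, 0) * \<psi> \<and>
           deriv h 0 = A + deriv (\<lambda>z. partial_w f (z, 0)) 0 * \<psi> + C * \<psi>\<^sup>2)"
proof -
  define F where "F = (\<lambda>z w. f (z, w))"
  define G where "G = w_quotient (w_quotient F)"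
  define \<phi> where "\<phi> = (\<lambda>z. f (z, 0))"
  define \<kappa> where "\<kappa> = (\<lambda>z. partial_w f (z, 0))"
  have \<kappa>_eq: "w_quotient F z 0 = \<kappa> z" for z
    by (simp add: \<kappa>_def partial_w_def w_quotient_def F_def)
  have \<kappa>: "\<kappa> holomorphic_on \<D>"
    unfolding \<kappa>_def by (rule holomorphic_partial_w_axis[OF f fD])
  have "separately_holomorphic_bounded F"
    unfolding F_def by (rule separately_holomorphic_bounded_curry[OF f fD])
  then have G: "separately_holomorphic_bounded G" "separately_holomorphic_bounded (w_quotient G)"
    unfolding G_def by (intro separately_holomorphic_bounded_w_quotient; assumption)+
  have G0: "(\<lambda>z. G z 0) holomorphic_on \<D>"
    using G(1) by (simp add: separately_holomorphic_bounded_def)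
  obtain K where K: "\<And>z w. z \<in> \<D> \<Longrightarrow> w \<in> \<D> \<Longrightarrow> cmod (w_quotient G z w) \<le> K"
    using G(2) unfolding separately_holomorphic_bounded_def by blast
  have \<phi>: "\<phi> holomorphic_on \<D>"
    unfolding \<phi>_def by (intro holomorphic2_on_compose[OF f] holomorphic_intros) auto
  obtain \<phi>1 where \<phi>1: "\<phi>1 holomorphic_on \<D>" and \<phi>\<phi>1: "\<And>z. cmod z < 1 \<Longrightarrow> \<phi> z = z * \<phi>1 z"
    and \<phi>10: "deriv \<phi> 0 = \<phi>1 0"
    by (rule Schwarz3[OF \<phi>]) (use f0 in \<open>auto simp: \<phi>_def\<close>)
  have d\<phi>1: "(\<phi>1 has_field_derivative deriv \<phi>1 z) (at z)" if "z \<in> \<D>" for z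
    using holomorphic_derivI[OF \<phi>1 _ that] by auto
  have pz: "partial_z f (z, 0) = \<phi>1 z + z * deriv \<phi>1 z" if z: "z \<in> \<D>" for z
  proof -
    have "((\<lambda>z. z * \<phi>1 z) has_field_derivative \<phi>1 z + z * deriv \<phi>1 z) (at z)"
      using d\<phi>1[OF z] by (auto intro!: derivative_eq_intros)
    then have "(\<phi> has_field_derivative \<phi>1 z + z * deriv \<phi>1 z) (at z)"
      by (rule has_field_derivative_transform_within_open[where S=\<D>]) (use z \<phi>\<phi>1 in auto)
    then show ?thesis
      by (simp add: partial_z_def \<phi>_def DERIV_imp_deriv)
  qed
  have dd: "(deriv \<phi>1 has_field_derivative deriv (deriv \<phi>1) 0) (at 0)"
    by (rule holomorphic_derivI[OF holomorphic_deriv[OF \<phi>1]]) auto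
  have "((\<lambda>z. \<phi>1 z + z * deriv \<phi>1 z) has_field_derivative 2 * deriv \<phi>1 0) (at 0)"
    using d\<phi>1[of 0] dd by (auto intro!: derivative_eq_intros)
  then have "((\<lambda>z. partial_z f (z, 0)) has_field_derivative 2 * deriv \<phi>1 0) (at 0)"
    by (rule has_field_derivative_transform_within_open[where S=\<D>]) (use pz in auto)
  then have A: "deriv (\<lambda>z. partial_z f (z, 0)) 0 = 2 * deriv \<phi>1 0"
    by (rule DERIV_imp_deriv)
  have main: "\<exists>h. h holomorphic_on \<D> \<and>
           (\<forall>x\<in>\<D>. cmod (h x) \<le> 1 \<and> f (x, x * \<psi>) = x * h x) \<and>
           h 0 = partial_z f (0, 0) + partial_w f (0, 0) * \<psi> \<and>
           deriv h 0 = deriv \<phi>1 0 + deriv (\<lambda>z. partial_w f (z, 0)) 0 * \<psi> + G 0 0 * \<psi>\<^sup>2"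
    if \<psi>: "cmod \<psi> = 1" for \<psi>
  proof -
    \<comment> \<open>Three quotients in \<open>w\<close> are taken: two yield the coefficients of
      \<open>w\<close> and \<open>w\<^sup>2\<close>, the third is the remainder. Its factor
      \<open>(x * \<psi>)^3\<close> becomes \<open>x\<^sup>2 * \<psi>^3\<close> once one
      \<open>x\<close> is factored out.\<close>
    define q where "q = (\<lambda>x. \<psi>^3 * w_quotient G x (x * \<psi>))"
    define h where "h = (\<lambda>x. \<phi>1 x + \<psi> * \<kappa> x + x * \<psi>\<^sup>2 * G x 0 + x\<^sup>2 * q x)"
    define g where "g = (\<lambda>x. f (x, x * \<psi>))"
    have gh: "g x = x * h x" if "x \<in> \<D>" for x
    proof -
      have "g x = F x (x * \<psi>)"
        by (simp add: g_def F_def)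
      also have "\<dots> = \<phi> x + x * \<psi> * (\<kappa> x + x * \<psi> * (G x 0 + x * \<psi> * w_quotient G x (x * \<psi>)))"
        using w_quotient_mult[of F x "x * \<psi>"] w_quotient_mult[of "w_quotient F" x "x * \<psi>"]
          w_quotient_mult[of G x "x * \<psi>"] \<kappa>_eq[of x]
        by (simp add: G_def F_def \<phi>_def)
      also have "\<dots> = x * h x"
        using \<phi>\<phi>1[of x] that by (simp add: h_def q_def power2_eq_square power3_eq_cube algebra_simps)
      finally show ?thesis .
    qed
    have gD: "cmod (g x) < 1" if "cmod x < 1" for x
    proof -
      have "f (x, x * \<psi>) \<in> \<D>"
        by (rule funcset_mem[OF fD]) (use that \<psi> in \<open>auto simp: norm_mult\<close>)
      then show ?thesis by (simp add: g_def)
    qed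
    have g: "g holomorphic_on \<D>"
      unfolding g_def
      by (intro holomorphic2_on_compose[OF f] holomorphic_intros) (auto simp: norm_mult \<psi>)
    have g0: "g 0 = 0"
      by (simp add: g_def f0)
    have "cmod (q x) \<le> K" if "x \<in> \<D>" for x
      using K[of x "x * \<psi>"] that \<psi> by (simp add: q_def norm_mult norm_power)
    then have dq: "((\<lambda>x. x\<^sup>2 * q x) has_field_derivative 0) (at 0)"
      by (rule DERIV_square_times_bounded)
    have "(\<kappa> has_field_derivative deriv \<kappa> 0) (at 0)"
      using holomorphic_derivI[OF \<kappa>] by auto
    moreover have "((\<lambda>z. G z 0) has_field_derivative deriv (\<lambda>z. G z 0) 0) (at 0)"
      using holomorphic_derivI[OF G0] by auto
    ultimately have "((\<lambda>x. \<phi>1 x + \<psi> * \<kappa> x + x * \<psi>\<^sup>2 * G x 0) has_field_derivative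
        deriv \<phi>1 0 + \<psi> * deriv \<kappa> 0 + \<psi>\<^sup>2 * G 0 0) (at 0)"
      using d\<phi>1[of 0] by (auto intro!: derivative_eq_intros)
    from DERIV_add[OF this dq]
    have dh: "(h has_field_derivative deriv \<phi>1 0 + \<psi> * deriv \<kappa> 0 + \<psi>\<^sup>2 * G 0 0) (at 0)"
      by (simp add: h_def)
    have "((\<lambda>x. x * h x) has_field_derivative h 0) (at 0)"
      by (rule derivative_eq_intros dh refl)+ simp
    then have "(g has_field_derivative h 0) (at 0)"
      by (rule has_field_derivative_transform_within_open[where S=\<D>]) (use gh in auto)
    then have h0: "deriv g 0 = h 0"
      by (rule DERIV_imp_deriv)
    \<comment> \<open>The formula for \<open>h\<close> involves \<open>q\<close>, which is not known
      to be holomorphic. Holomorphy comes instead from \<open>h\<close> being the difference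
      quotient of \<open>g\<close>, with value \<open>deriv g 0\<close> at 0.\<close>
    have "(\<lambda>z. if z = 0 then deriv g 0 else (g z - g 0) / (z - 0)) holomorphic_on \<D>"
      by (rule pole_lemma[OF g]) auto
    then have hol: "h holomorphic_on \<D>"
      by (rule holomorphic_transform) (use gh g0 h0 in auto)
    have le: "cmod (h x) \<le> 1" if x: "x \<in> \<D>" for x
    proof (cases "x = 0")
      case True
      then show ?thesis
        using Schwarz_Lemma(2)[OF g g0 gD, of 0] h0 by simp
    next
      case False
      then show ?thesis
        using Schwarz_Lemma(1)[OF g g0 gD, of x] gh[OF x] x by (simp add: norm_mult)
    qed
    have "h 0 = partial_z f (0, 0) + partial_w f (0, 0) * \<psi>"
      using pz[of 0] by (simp add: h_def \<kappa>_def mult.commute)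
    moreover have "deriv h 0 = deriv \<phi>1 0 + deriv \<kappa> 0 * \<psi> + G 0 0 * \<psi>\<^sup>2"
      using DERIV_imp_deriv[OF dh] by (simp add: mult.commute)
    ultimately show ?thesis
      using hol le gh unfolding g_def \<kappa>_def by blast
  qed
  show ?thesis
    by (rule that[OF A]) (use main in blast)
qed

section \<open>Limits on the unit circle and uniqueness on the bidisk\<close>

lemma cis_near_one:
  assumes "e > 0"
  obtains s where "cis s \<noteq> 1" "cmod (1 - cis s) < e"
proof -
  have "((\<lambda>s. 1 - cis s) \<longlongrightarrow> 1 - cis 0) (at_right 0)"
    by (intro tendsto_intros)
  then have "\<forall>\<^sub>F s in at_right 0. cmod (1 - cis s) < e"
    using tendstoD[OF _ assms] by (fastforce simp: dist_norm)
  moreover have "\<forall>\<^sub>F s::real in at_right 0. s \<in> {0<..<1}"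
    by (rule eventually_at_right_real) simp
  ultimately have "\<forall>\<^sub>F s in at_right 0. cmod (1 - cis s) < e \<and> s \<in> {0<..<1::real}"
    by (rule eventually_conj)
  then obtain s where s: "cmod (1 - cis s) < e" "0 < s" "s < 1"
    using eventually_happens by fastforce
  have "sin s > 0"
    using s pi_gt3 by (intro sin_gt_zero) auto
  then have "cis s \<noteq> 1"
    by (auto simp: complex_eq_iff)
  then show ?thesis
    using that s by blast
qed

text \<open>\<open>X\<close> does not vary with \<open>\<psi>\<close>, so letting
  \<open>\<psi>\<close> tend to 1 on the circle forces it to vanish. The instance
  \<open>\<psi> = -1\<close> shows \<open>c > 0\<close>, which permits dividing by
  \<open>c\<close>.\<close>

lemma zero_if_small_near_one:
  fixes X :: complex
  assumes "\<And>\<psi>. cmod \<psi> = 1 \<Longrightarrow> \<psi> \<noteq> 1 \<Longrightarrow> cmod X \<le> c * cmod (1 - \<psi>)"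
  shows "X = 0"
proof (rule ccontr)
  assume X: "X \<noteq> 0"
  have "0 < cmod X"
    using X by simp
  also have "cmod X \<le> c * cmod (1 - (- 1))"
    by (rule assms) auto
  finally have c: "c > 0"
    by simp
  obtain s where "cis s \<noteq> 1" "cmod (1 - cis s) < cmod X / c"
    using cis_near_one[of "cmod X / c"] X c by auto
  then show False
    using assms[of "cis s"] c by (simp add: field_simps)
qed

text \<open>The bound forces a double zero at 1, so the polynomial is
  \<open>A * (1 - \<psi>)\<^sup>2\<close>. Vanishing at 1 gives \<open>sum0\<close>; dividing by
  \<open>1 - \<psi>\<close> leaves \<open>A - C * \<psi>\<close>, which is again small near
  1.\<close>

lemma quadratic_double_zero:
  fixes A B C :: complex
  assumes le: "\<And>\<psi>. cmod \<psi> = 1 \<Longrightarrow> \<psi> \<noteq> 1 \<Longrightarrow> cmod (A + B * \<psi> + C * \<psi>\<^sup>2) \<le> c * (cmod (1 - \<psi>))\<^sup>2"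
  shows "C = A" "B = - 2 * A"
proof -
  have d2: "cmod (1 - \<psi>) \<le> 2" if "cmod \<psi> = 1" for \<psi> :: complex
    using norm_triangle_ineq4[of 1 \<psi>] that by simp
  have "0 \<le> cmod (A + B * (- 1) + C * (- 1)\<^sup>2)"
    by simp
  also have "\<dots> \<le> c * (cmod (1 - (- 1)))\<^sup>2"
    by (rule le) auto
  finally have c: "c \<ge> 0"
    by simp
  have sum0: "A + B + C = 0"
  \<comment> \<open>The constant arises by bounding one factor \<open>cmod (1 - \<psi>)\<close> of
    the hypothesis, and \<open>cmod (1 + \<psi>)\<close> in the \<open>C\<close> term, by 2.\<close>
  proof (rule zero_if_small_near_one[where c = "c * 2 + cmod B + cmod C * 2"])
    fix \<psi> :: complex assume \<psi>: "cmod \<psi> = 1" "\<psi> \<noteq> 1"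
    have "A + B + C = (A + B * \<psi> + C * \<psi>\<^sup>2) + B * (1 - \<psi>) + C * ((1 + \<psi>) * (1 - \<psi>))"
      by (simp add: algebra_simps power2_eq_square)
    then have "cmod (A + B + C) \<le> cmod (A + B * \<psi> + C * \<psi>\<^sup>2) + cmod B * cmod (1 - \<psi>)
        + cmod C * (cmod (1 + \<psi>) * cmod (1 - \<psi>))"
      by (metis norm_mult norm_triangle_mono order_refl)
    moreover have "cmod (A + B * \<psi> + C * \<psi>\<^sup>2) \<le> c * (2 * cmod (1 - \<psi>))"
      using le[OF \<psi>] mult_left_mono[OF mult_right_mono[OF d2[OF \<psi>(1)] norm_ge_zero[of "1 - \<psi>"]] c]
      by (simp add: power2_eq_square)
    moreover have "cmod C * (cmod (1 + \<psi>) * cmod (1 - \<psi>)) \<le> cmod C * (2 * cmod (1 - \<psi>))"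
      using norm_triangle_ineq[of 1 \<psi>] \<psi> by (intro mult_left_mono mult_right_mono) auto
    ultimately show "cmod (A + B + C) \<le> (c * 2 + cmod B + cmod C * 2) * cmod (1 - \<psi>)"
      by (simp add: algebra_simps)
  qed
  have "C - A = 0"
  proof (rule zero_if_small_near_one[where c = "c + cmod C"])
    fix \<psi> :: complex assume \<psi>: "cmod \<psi> = 1" "\<psi> \<noteq> 1"
    have B: "B = - A - C"
      using sum0 by (simp add: algebra_simps eq_neg_iff_add_eq_0)
    have "A + B * \<psi> + C * \<psi>\<^sup>2 = (A - C * \<psi>) * (1 - \<psi>)"
      by (simp add: B algebra_simps power2_eq_square)
    then have "cmod (A - C * \<psi>) * cmod (1 - \<psi>) \<le> c * cmod (1 - \<psi>) * cmod (1 - \<psi>)"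
      using le[OF \<psi>] by (simp add: norm_mult power2_eq_square)
    then have "cmod (A - C * \<psi>) \<le> c * cmod (1 - \<psi>)"
      using \<psi> by simp
    moreover have "C - A = C * (1 - \<psi>) - (A - C * \<psi>)"
      by (simp add: algebra_simps)
    then have "cmod (C - A) \<le> cmod C * cmod (1 - \<psi>) + cmod (A - C * \<psi>)"
      by (metis norm_mult norm_triangle_ineq4)
    ultimately show "cmod (C - A) \<le> (c + cmod C) * cmod (1 - \<psi>)"
      by (simp add: distrib_right)
  qed
  then show "C = A" by simp
  with sum0 show "B = - 2 * A"
    by (simp add: algebra_simps eq_neg_iff_add_eq_0)
qed

text \<open>For fixed nonzero \<open>x\<close> the points \<open>x * \<psi>\<close> accumulate at
  \<open>x\<close>, so the identity theorem in the second variable gives \<open>g x w = 0\<close>;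
  the identity theorem in the first variable then covers \<open>z = 0\<close>. The value
  \<open>\<psi> = 1\<close> is left out because in \<open>extremal_normalized\<close> that slice has
  \<open>h 0 = 1\<close>, where \<open>schwarz_pick_origin\<close> does not apply.\<close>

lemma vanishing_on_torus_discs:
  fixes g :: "complex \<Rightarrow> complex \<Rightarrow> complex"
  assumes gz: "\<And>w. w \<in> \<D> \<Longrightarrow> (\<lambda>z. g z w) holomorphic_on \<D>"
    and gw: "\<And>z. z \<in> \<D> \<Longrightarrow> g z holomorphic_on \<D>"
    and zero: "\<And>x \<psi>. x \<in> \<D> \<Longrightarrow> cmod \<psi> = 1 \<Longrightarrow> \<psi> \<noteq> 1 \<Longrightarrow> g x (x * \<psi>) = 0"
    and z: "z \<in> \<D>" and w: "w \<in> \<D>"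
  shows "g z w = 0"
proof -
  have nz: "g x w = 0" if x: "x \<in> \<D>" "x \<noteq> 0" for x
  proof (rule analytic_continuation[OF gw[OF x(1)], where U = "{x * \<psi> |\<psi>. cmod \<psi> = 1 \<and> \<psi> \<noteq> 1}" and \<xi> = x])
    show "x islimpt {x * \<psi> |\<psi>. cmod \<psi> = 1 \<and> \<psi> \<noteq> 1}"
      unfolding islimpt_approachable
    proof (intro allI impI)
      fix e :: real assume "e > 0"
      then obtain s where s: "cis s \<noteq> 1" "cmod (1 - cis s) < e / cmod x"
        using cis_near_one[of "e / cmod x"] x by auto
      have "dist (x * cis s) x = cmod x * cmod (1 - cis s)"
        by (simp add: dist_norm norm_minus_commute flip: norm_mult) (simp add: algebra_simps)
      also have "\<dots> < e"
        using s(2) x by (simp add: field_simps)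
      finally show "\<exists>x'\<in>{x * \<psi> |\<psi>. cmod \<psi> = 1 \<and> \<psi> \<noteq> 1}. x' \<noteq> x \<and> dist x' x < e"
        using s(1) x by (intro bexI[of _ "x * cis s"]) auto
    qed
  qed (use x w zero in \<open>auto simp: norm_mult\<close>)
  show ?thesis
  proof (rule analytic_continuation[OF gz[OF w], where U = "\<D> - {0}" and \<xi> = 0])
    show "(0::complex) islimpt \<D> - {0}"
      using islimpt_punctured[of 0 \<D>] by (simp add: islimpt_ball)
  qed (use nz z in auto)
qed

section \<open>Rigidity\<close>

text \<open>Here \<open>p = f\<^sub>z\<close>, \<open>q = f\<^sub>w\<close> and \<open>\<phi> = f\<close> along \<open>w = 0\<close>. Holomorphic square roots turn \<open>|p|\<close> and \<open>|q|\<close> into squared moduli,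
  whose averages only see \<open>|A|\<^sup>2\<close>.\<close>

lemma extremal_second_order:
  fixes t :: real
  assumes p: "p holomorphic_on \<D>" and q: "q holomorphic_on \<D>" and \<phi>: "\<phi> holomorphic_on \<D>"
    and t: "0 < t" "t < 1" and p0: "p 0 = of_real t" and q0: "q 0 = of_real (1 - t)"
    and \<phi>0: "\<phi> 0 = 0" and d\<phi>: "deriv \<phi> 0 = of_real t"
    and dp: "deriv p 0 = 2 * A" and dq: "deriv q 0 = - 2 * A"
    and ext: "\<And>z. z \<in> \<D> \<Longrightarrow> (1 - (cmod z)\<^sup>2) * cmod (p z) + cmod (q z) = 1 - (cmod (\<phi> z))\<^sup>2"
  shows "cmod A = t * (1 - t)"
proof -
  \<comment> \<open>Near 0 the values of \<open>u\<close> stay within distance less than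
    \<open>c\<close> of \<open>c\<close>, hence in the right half-plane and off the branch cut of
    \<open>csqrt\<close>. For \<open>deriv u 0\<close> equal to \<open>2 * A\<close> or
    \<open>- 2 * A\<close> the last formula gives \<open>(cmod A)\<^sup>2 / c\<close>.\<close>
  have root: "\<exists>e>0. \<exists>P. P holomorphic_on ball 0 e \<and> (\<forall>z. (cmod (P z))\<^sup>2 = cmod (u z)) \<and>
                (cmod (deriv P 0))\<^sup>2 = (cmod (deriv u 0))\<^sup>2 / (4 * cmod (u 0))"
    if u: "u holomorphic_on \<D>" and u0: "u 0 = of_real c" and c: "c > 0" for u :: "complex \<Rightarrow> complex" and c
  proof -
    have "isCont u 0"
      using holomorphic_on_imp_continuous_on[OF u] by (simp add: continuous_on_eq_continuous_at)
    then obtain d where d: "d > 0" "\<And>z. dist z 0 < d \<Longrightarrow> dist (u z) (u 0) < c"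
      using c unfolding continuous_at_eps_delta by metis
    define e where "e = min d 1"
    have e: "e > 0" "ball 0 e \<subseteq> (\<D> :: complex set)"
      using d by (auto simp: e_def)
    have nonpos: "u z \<notin> \<real>\<^sub>\<le>\<^sub>0" if "z \<in> ball 0 e" for z
    proof -
      have "cmod (u z - of_real c) < c"
        using d(2)[of z] that u0 by (simp add: e_def dist_norm)
      then have "\<bar>Re (u z - of_real c)\<bar> < c"
        using abs_Re_le_cmod order_le_less_trans by blast
      then have "Re (u z) > 0"
        by (auto simp: abs_if split: if_splits)
      then show ?thesis
        by (auto simp: complex_nonpos_Reals_iff)
    qed
    have hol: "(\<lambda>z. csqrt (u z)) holomorphic_on ball 0 e"
      using holomorphic_on_subset[OF u e(2)] nonpos by (intro holomorphic_intros) auto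
    have sq: "(cmod (csqrt (u z)))\<^sup>2 = cmod (u z)" for z
      by (simp flip: norm_power)
    have "(u has_field_derivative deriv u 0) (at 0)"
      using holomorphic_derivI[OF u] by auto
    then have "((\<lambda>z. csqrt (u z)) has_field_derivative deriv u 0 / (2 * csqrt (u 0))) (at 0)"
      using nonpos[of 0] e by (intro has_field_derivative_csqrt') auto
    then have "deriv (\<lambda>z. csqrt (u z)) 0 = deriv u 0 / (2 * csqrt (u 0))"
      by (rule DERIV_imp_deriv)
    then have "(cmod (deriv (\<lambda>z. csqrt (u z)) 0))\<^sup>2 = (cmod (deriv u 0))\<^sup>2 / (4 * cmod (u 0))"
      by (simp add: norm_divide norm_mult power_divide power_mult_distrib sq del: norm_csqrt)
    with e hol sq show ?thesis by blast
  qed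
  obtain e1 P where e1: "e1 > 0" and P: "P holomorphic_on ball 0 e1" "\<And>z. (cmod (P z))\<^sup>2 = cmod (p z)"
    "(cmod (deriv P 0))\<^sup>2 = (cmod A)\<^sup>2 / t"
    using root[OF p p0 t(1)] t by (auto simp: dp p0 norm_mult power_mult_distrib)
  obtain e2 R where e2: "e2 > 0" and R: "R holomorphic_on ball 0 e2" "\<And>z. (cmod (R z))\<^sup>2 = cmod (q z)"
    "(cmod (deriv R 0))\<^sup>2 = (cmod A)\<^sup>2 / (1 - t)"
  proof -
    have "4 * x / (4 - 4 * t) = x / (1 - t)" for x
      using t by (simp add: divide_simps)
    then show ?thesis
      using that root[OF q q0] t
      by (auto simp: dq q0 norm_mult power_mult_distrib simp del: of_real_diff)
  qed
  define SP SR S\<phi> where "SP = quad_sum (\<lambda>h. cmod (p h))" and "SR = quad_sum (\<lambda>h. cmod (q h))"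
    and "S\<phi> = quad_sum (\<lambda>h. (cmod (\<phi> h))\<^sup>2)"
  have lP: "((\<lambda>r. (SP r - 4 * t) / r\<^sup>2) \<longlongrightarrow> 4 * ((cmod A)\<^sup>2 / t)) (at_right 0)"
    using quad_sum_norm_square_tendsto[OF P(1) e1] t by (simp add: P SP_def p0)
  have lR: "((\<lambda>r. (SR r - 4 * (1 - t)) / r\<^sup>2) \<longlongrightarrow> 4 * ((cmod A)\<^sup>2 / (1 - t))) (at_right 0)"
    using quad_sum_norm_square_tendsto[OF R(1) e2] t by (simp add: R SR_def q0 del: of_real_diff)
  have l\<phi>: "((\<lambda>r. S\<phi> r / r\<^sup>2) \<longlongrightarrow> 4 * t\<^sup>2) (at_right 0)"
    using quad_sum_norm_square_tendsto[OF \<phi>] by (simp add: S\<phi>_def \<phi>0 d\<phi>)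
  \<comment> \<open>The summed equation \<open>(1 - r\<^sup>2) * SP r + SR r = 4 - S\<phi> r\<close>
    is divided by \<open>r\<^sup>2\<close>; the last bracket is \<open>SP r\<close>, rewritten to
    have a known limit. The expression is 0 for small \<open>r\<close>, so its limit 4|A|^2/t +
    4|A|^2/(1-t) - 4t(1-t) vanishes.\<close>
  have "((\<lambda>r. (SP r - 4 * t) / r\<^sup>2 + (SR r - 4 * (1 - t)) / r\<^sup>2 + S\<phi> r / r\<^sup>2
            - (4 * t + r\<^sup>2 * ((SP r - 4 * t) / r\<^sup>2)))
        \<longlongrightarrow> 4 * ((cmod A)\<^sup>2 / t) + 4 * ((cmod A)\<^sup>2 / (1 - t)) + 4 * t\<^sup>2
            - (4 * t + 0\<^sup>2 * (4 * ((cmod A)\<^sup>2 / t)))) (at_right 0)"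
    by (intro tendsto_intros lP lR l\<phi>)
  moreover have "\<forall>\<^sub>F r in at_right 0. (SP r - 4 * t) / r\<^sup>2 + (SR r - 4 * (1 - t)) / r\<^sup>2 + S\<phi> r / r\<^sup>2
            - (4 * t + r\<^sup>2 * ((SP r - 4 * t) / r\<^sup>2)) = 0"
  proof -
    have "\<forall>\<^sub>F r::real in at_right 0. r \<in> {0<..<1}"
      by (rule eventually_at_right_real) simp
    then show ?thesis
    proof eventually_elim
      case (elim r)
      have r: "r \<noteq> 0" using elim by simp
      have pt: "(1 - r\<^sup>2) * cmod (p z) + cmod (q z) = 1 - (cmod (\<phi> z))\<^sup>2" if "cmod z = r" for z
        using ext[of z] that elim by simp
      have "(1 - r\<^sup>2) * SP r + SR r = 4 - S\<phi> r"
        using elim pt[of "of_real r"] pt[of "\<i> * of_real r"] pt[of "- of_real r"] pt[of "- \<i> * of_real r"]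
        by (simp add: SP_def SR_def S\<phi>_def quad_sum_def distrib_left norm_mult)
      then have "SR r = 4 - S\<phi> r - (1 - r\<^sup>2) * SP r"
        by simp
      then show ?case
        using r by (simp add: field_simps)
    qed
  qed
  ultimately have "((\<lambda>r::real. 0::real) \<longlongrightarrow> 4 * ((cmod A)\<^sup>2 / t) + 4 * ((cmod A)\<^sup>2 / (1 - t)) + 4 * t\<^sup>2
            - (4 * t + 0\<^sup>2 * (4 * ((cmod A)\<^sup>2 / t)))) (at_right 0)"
    by (rule Lim_transform_eventually)
  then have "4 * ((cmod A)\<^sup>2 / t) + 4 * ((cmod A)\<^sup>2 / (1 - t)) + 4 * t\<^sup>2
            - (4 * t + 0\<^sup>2 * (4 * ((cmod A)\<^sup>2 / t))) = 0"
    by (rule tendsto_unique[OF trivial_limit_at_right_real _ tendsto_const])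
  then have "(cmod A)\<^sup>2 / t + (cmod A)\<^sup>2 / (1 - t) = t * (1 - t)"
    by (simp add: power2_eq_square[of t] right_diff_distrib)
  moreover have "(cmod A)\<^sup>2 / t + (cmod A)\<^sup>2 / (1 - t) = (cmod A)\<^sup>2 / (t * (1 - t))"
    using t by (simp add: divide_simps) (simp add: algebra_simps)
  ultimately have "(cmod A)\<^sup>2 = (t * (1 - t))\<^sup>2"
    using t by (simp add: divide_simps power2_eq_square)
  then show ?thesis
    using t by (simp add: power2_eq_iff_nonneg)
qed

text \<open>With \<open>0 < t < 1\<close> every slice with \<open>\<psi> \<noteq> 1\<close> has
  \<open>cmod (h 0) < 1\<close>, and the value of \<open>cmod A\<close> makes Schwarz-Pick sharp on
  all of them with one common phase \<open>\<Theta>\<close>. Clearing denominators turns the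
  conclusion into the vanishing of a holomorphic function, to which uniqueness applies.\<close>

lemma extremal_normalized:
  fixes f :: "complex \<times> complex \<Rightarrow> complex" and t :: real
  assumes f: "f holomorphic2_on \<D>\<^sup>2" and fD: "f \<in> \<D>\<^sup>2 \<rightarrow> \<D>" and f0: "f (0, 0) = 0"
    and t: "0 < t" "t < 1" and fz: "partial_z f (0, 0) = of_real t"
    and fw: "partial_w f (0, 0) = of_real (1 - t)"
    and ext: "\<And>z. z \<in> \<D> \<Longrightarrow>
      (1 - (cmod z)\<^sup>2) * cmod (partial_z f (z, 0)) + cmod (partial_w f (z, 0)) = 1 - (cmod (f (z, 0)))\<^sup>2"
  obtains \<Theta> where "cmod \<Theta> = 1"
    and "\<And>z w :: complex. z \<in> \<D> \<Longrightarrow> w \<in> \<D> \<Longrightarrow>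
      f (z, w) * (1 - \<Theta> * (of_real (1 - t) * z + of_real t * w))
        = of_real t * z + of_real (1 - t) * w - \<Theta> * z * w"
proof -
  define B where "B = deriv (\<lambda>z. partial_w f (z, 0)) 0"
  obtain A C where dz: "deriv (\<lambda>z. partial_z f (z, 0)) 0 = 2 * A"
    and slice_all: "\<forall>\<psi>. cmod \<psi> = 1 \<longrightarrow> (\<exists>h. h holomorphic_on \<D> \<and>
           (\<forall>x\<in>\<D>. cmod (h x) \<le> 1 \<and> f (x, x * \<psi>) = x * h x) \<and>
           h 0 = of_real t + of_real (1 - t) * \<psi> \<and> deriv h 0 = A + B * \<psi> + C * \<psi>\<^sup>2)"
    by (rule slice_quotient[OF f fD f0, unfolded fz fw B_def[symmetric]])
  note slice = slice_all[rule_format]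
  define s where "s = (\<lambda>\<psi>. t * (1 - t) * (cmod (1 - \<psi>))\<^sup>2)"
  have s_pos: "s \<psi> > 0" if "\<psi> \<noteq> 1" for \<psi>
    using that t by (simp add: s_def)
  have unit: "(Re \<psi>)\<^sup>2 + (Im \<psi>)\<^sup>2 = 1" if "cmod \<psi> = 1" for \<psi>
    using that by (simp flip: cmod_power2)
  \<comment> \<open>This measures how far a convex combination of 1 and \<open>\<psi>\<close> lies
    inside the circle. Its second-order vanishing at 1 is what \<open>quadratic_double_zero\<close>
    exploits.\<close>
  have defect: "1 - (cmod (of_real t + of_real (1 - t) * \<psi>))\<^sup>2 = s \<psi>" if "cmod \<psi> = 1" for \<psi>
    using unit[OF that] unfolding s_def cmod_power2 by (simp, algebra)
  have h0: "cmod (of_real t + of_real (1 - t) * \<psi>) < 1" if "cmod \<psi> = 1" "\<psi> \<noteq> 1" for \<psi>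
    using defect[OF that(1)] s_pos[OF that(2)] by (smt (verit) norm_ge_zero one_le_power)
  have "cmod (A + B * \<psi> + C * \<psi>\<^sup>2) \<le> t * (1 - t) * (cmod (1 - \<psi>))\<^sup>2"
    if \<psi>: "cmod \<psi> = 1" "\<psi> \<noteq> 1" for \<psi>
  proof -
    obtain h where "h holomorphic_on \<D>" "\<And>x. x \<in> \<D> \<Longrightarrow> cmod (h x) \<le> 1"
      and h: "h 0 = of_real t + of_real (1 - t) * \<psi>" "deriv h 0 = A + B * \<psi> + C * \<psi>\<^sup>2"
      using slice[OF \<psi>(1)] by blast
    then have "cmod (deriv h 0) \<le> 1 - (cmod (h 0))\<^sup>2"
      using h0[OF \<psi>] by (intro schwarz_pick_origin(1)) auto
    then show ?thesis
      unfolding h defect[OF \<psi>(1)] s_def .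
  qed
  then have CB: "C = A" "B = - 2 * A"
    using quadratic_double_zero[of A B C "t * (1 - t)"] by blast+
  have A: "cmod A = t * (1 - t)"
  proof (rule extremal_second_order[OF _ _ _ t fz fw f0 _ dz _ ext])
    have hol: "(\<lambda>z. f (z, 0)) holomorphic_on \<D>"
      by (intro holomorphic2_on_compose[OF f] holomorphic_intros) auto
    then show "(\<lambda>z. f (z, 0)) holomorphic_on \<D>" .
    show "(\<lambda>z. partial_z f (z, 0)) holomorphic_on \<D>"
      using holomorphic_deriv[OF hol] by (simp add: partial_z_def)
    show "(\<lambda>z. partial_w f (z, 0)) holomorphic_on \<D>"
      by (rule holomorphic_partial_w_axis[OF f fD])
    show "deriv (\<lambda>z. f (z, 0)) 0 = of_real t"
      using fz by (simp add: partial_z_def)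
    show "deriv (\<lambda>z. partial_w f (z, 0)) 0 = - 2 * A"
      using CB by (simp add: B_def)
  qed
  define \<Theta> where "\<Theta> = A / of_real (t * (1 - t))"
  have A\<Theta>: "A = of_real (t * (1 - t)) * \<Theta>"
    using t by (simp add: \<Theta>_def)
  have \<Theta>: "cmod \<Theta> = 1"
    using A t by (simp add: \<Theta>_def norm_divide norm_mult del: of_real_mult of_real_diff)
  define g where "g = (\<lambda>z w :: complex. f (z, w) * (1 - \<Theta> * (of_real (1 - t) * z + of_real t * w))
      - (of_real t * z + of_real (1 - t) * w - \<Theta> * z * w))"
  have slice0: "g x (x * \<psi>) = 0" if x: "x \<in> \<D>" and \<psi>: "cmod \<psi> = 1" "\<psi> \<noteq> 1" for x \<psi>
  proof -
    obtain h where hol: "h holomorphic_on \<D>" and le: "\<And>x. x \<in> \<D> \<Longrightarrow> cmod (h x) \<le> 1"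
      and fh: "f (x, x * \<psi>) = x * h x"
      and h: "h 0 = of_real t + of_real (1 - t) * \<psi>" "deriv h 0 = A + B * \<psi> + C * \<psi>\<^sup>2"
      using slice[OF \<psi>(1)] x by blast
    have cnj: "\<psi> * cnj \<psi> = 1"
      using \<psi>(1) by (simp flip: complex_norm_square)
    \<comment> \<open>On the circle \<open>(1 - \<psi>)\<^sup>2\<close> is \<open>- \<psi>\<close>
      times a positive number. Hence \<open>deriv h 0\<close> has modulus exactly
      \<open>s \<psi>\<close>, the equality case, and the phase of
      \<open>- \<Theta> * \<psi>\<close>.\<close>
    have "(1 - \<psi>)\<^sup>2 = - \<psi> * ((1 - \<psi>) * cnj (1 - \<psi>))"
      using cnj by simp algebra
    also have "(1 - \<psi>) * cnj (1 - \<psi>) = of_real ((cmod (1 - \<psi>))\<^sup>2)"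
      by (rule complex_norm_square[symmetric])
    finally have sq: "(1 - \<psi>)\<^sup>2 = - \<psi> * of_real ((cmod (1 - \<psi>))\<^sup>2)" .
    have "deriv h 0 = A * (1 - \<psi>)\<^sup>2"
      unfolding h CB by (simp add: power2_eq_square algebra_simps)
    then have dh: "deriv h 0 = - \<Theta> * \<psi> * of_real (s \<psi>)"
      unfolding sq A\<Theta> s_def by simp
    have hs: "1 - (cmod (h 0))\<^sup>2 = s \<psi>"
      using defect[OF \<psi>(1)] by (simp add: h)
    have "cmod (deriv h 0) = 1 - (cmod (h 0))\<^sup>2"
      unfolding hs using \<Theta> \<psi> s_pos[OF \<psi>(2)] by (simp add: dh norm_mult)
    from schwarz_pick_origin(2)[OF hol le _ this x] h0[OF \<psi>]
    have "h x * (of_real (1 - (cmod (h 0))\<^sup>2) + cnj (h 0) * deriv h 0 * x)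
            = h 0 * of_real (1 - (cmod (h 0))\<^sup>2) + deriv h 0 * x"
      by (simp add: h)
    then have "h x * (1 - cnj (h 0) * \<Theta> * \<psi> * x) * of_real (s \<psi>)
        = (h 0 - \<Theta> * \<psi> * x) * of_real (s \<psi>)"
      unfolding hs dh by (simp add: algebra_simps)
    then have "h x * (1 - cnj (h 0) * \<Theta> * \<psi> * x) = h 0 - \<Theta> * \<psi> * x"
      using s_pos[OF \<psi>(2)] by simp
    \<comment> \<open>Multiplying \<open>cnj (h 0)\<close> by \<open>\<psi>\<close> exchanges the
      weights \<open>t\<close> and \<open>1 - t\<close>, which is why numerator and denominator
      carry them in opposite order.\<close>
    moreover have "cnj (h 0) * \<Theta> * \<psi> * x = \<Theta> * (of_real (1 - t) * x + of_real t * (x * \<psi>))"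
      using cnj by (simp add: h) algebra
    ultimately have "h x * (1 - \<Theta> * (of_real (1 - t) * x + of_real t * (x * \<psi>))) = h 0 - \<Theta> * \<psi> * x"
      by simp
    then have eq: "x * h x * (1 - \<Theta> * (of_real (1 - t) * x + of_real t * (x * \<psi>))) = x * (h 0 - \<Theta> * \<psi> * x)"
      by (simp only: mult.assoc)
    show ?thesis
      unfolding g_def fh eq h by (simp add: algebra_simps)
  qed
  have "g z w = 0" if "z \<in> \<D>" "w \<in> \<D>" for z w
  proof (rule vanishing_on_torus_discs[where g = g, OF _ _ slice0 that])
    show "(\<lambda>z. g z w) holomorphic_on \<D>" if "w \<in> \<D>" for w
      unfolding g_def using that by (intro holomorphic2_on_compose[OF f] holomorphic_intros) auto
    show "g z holomorphic_on \<D>" if "z \<in> \<D>" for z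
      unfolding g_def using that by (intro holomorphic2_on_compose[OF f] holomorphic_intros) auto
  qed
  then show ?thesis
    using that[OF \<Theta>] by (simp add: g_def)
qed

text \<open>When one derivative vanishes the other is unimodular, so \<open>h 0\<close> lies on the
  unit circle for every \<open>\<psi>\<close>, and the maximum principle makes each slice quotient
  constant.\<close>

lemma extremal_degenerate:
  fixes f :: "complex \<times> complex \<Rightarrow> complex"
  assumes f: "f holomorphic2_on \<D>\<^sup>2" and fD: "f \<in> \<D>\<^sup>2 \<rightarrow> \<D>" and f0: "f (0, 0) = 0"
    and fz: "partial_z f (0, 0) = a" and fw: "partial_w f (0, 0) = b"
    and ab: "cmod a + cmod b = 1" "a = 0 \<or> b = 0"
    and z: "z \<in> \<D>" and w: "w \<in> \<D>"
  shows "f (z, w) = a * z + b * w"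
proof -
  define B where "B = deriv (\<lambda>z. partial_w f (z, 0)) 0"
  obtain A C where "deriv (\<lambda>z. partial_z f (z, 0)) 0 = 2 * A"
    and slice_all: "\<forall>\<psi>. cmod \<psi> = 1 \<longrightarrow> (\<exists>h. h holomorphic_on \<D> \<and>
           (\<forall>x\<in>\<D>. cmod (h x) \<le> 1 \<and> f (x, x * \<psi>) = x * h x) \<and>
           h 0 = a + b * \<psi> \<and> deriv h 0 = A + B * \<psi> + C * \<psi>\<^sup>2)"
    by (rule slice_quotient[OF f fD f0, unfolded fz fw B_def[symmetric]])
  note slice = slice_all[rule_format]
  have slice0: "f (x, x * \<psi>) - (a * x + b * (x * \<psi>)) = 0" if x: "x \<in> \<D>" and \<psi>: "cmod \<psi> = 1" for x \<psi>
  proof -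
    obtain h where hol: "h holomorphic_on \<D>" and le: "\<And>x. x \<in> \<D> \<Longrightarrow> cmod (h x) \<le> 1"
      and fh: "f (x, x * \<psi>) = x * h x" and h0: "h 0 = a + b * \<psi>"
      using slice[OF \<psi>] x by blast
    have "cmod (h 0) = 1"
      using ab \<psi> by (auto simp: h0 norm_mult)
    from schur_unimodular_constant[OF hol le this x] show ?thesis
      by (simp add: fh h0) (simp add: algebra_simps)
  qed
  have "f (z, w) - (a * z + b * w) = 0"
  proof (rule vanishing_on_torus_discs[where g = "\<lambda>z w. f (z, w) - (a * z + b * w)", OF _ _ slice0 z w])
    show "(\<lambda>z. f (z, w) - (a * z + b * w)) holomorphic_on \<D>" if "w \<in> \<D>" for w
      using that by (intro holomorphic2_on_compose[OF f] holomorphic_intros) auto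
    show "(\<lambda>w. f (z, w) - (a * z + b * w)) holomorphic_on \<D>" if "z \<in> \<D>" for z
      using that by (intro holomorphic2_on_compose[OF f] holomorphic_intros) auto
  qed
  then show ?thesis by simp
qed

section \<open>The model functions\<close>

text \<open>This is the extremality equation of the model with its phases removed, multiplied by the
  squared modulus of the denominator. In real and imaginary parts it is a polynomial
  identity.\<close>

lemma extremal_identity:
  fixes u v :: complex and t :: real
  shows "(1 - (cmod u)\<^sup>2) * (t * (cmod (1 - v))\<^sup>2) + (1 - (cmod v)\<^sup>2) * ((1 - t) * (cmod (1 - u))\<^sup>2)
    = (cmod (1 - of_real (1 - t) * u - of_real t * v))\<^sup>2
      - (cmod (of_real t * u + of_real (1 - t) * v - u * v))\<^sup>2"
  unfolding cmod_power2 by simp algebra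

lemma denominator_nonzero:
  fixes a b z w :: complex
  assumes ab: "cmod a + cmod b = 1" and z: "cmod z < 1" and w: "cmod w < 1"
  shows "1 - cnj b * z - cnj a * w \<noteq> 0"
proof
  assume "1 - cnj b * z - cnj a * w = 0"
  then have "1 = cmod (cnj b * z + cnj a * w)"
    by (simp add: diff_diff_eq)
  also have "\<dots> \<le> cmod b * cmod z + cmod a * cmod w"
    by (metis norm_triangle_ineq norm_mult complex_mod_cnj)
  finally have 1: "1 \<le> cmod b * cmod z + cmod a * cmod w" .
  have "cmod b * cmod z \<le> cmod b" "cmod a * cmod w \<le> cmod a"
    using z w by (simp_all add: mult_left_le)
  moreover have "cmod b * cmod z < cmod b \<or> cmod a * cmod w < cmod a"
    using ab z w by (cases "a = 0") auto
  ultimately show False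
    using 1 ab by linarith
qed

text \<open>Zero also receives a phase of modulus 1, so \<open>a = 0\<close> and
  \<open>b = 0\<close> need no separate treatment in \<open>model_extremal\<close>.\<close>

lemma polar_form: obtains \<alpha> where "cmod \<alpha> = 1" "a = of_real (cmod a) * \<alpha>"
proof (cases "a = 0")
  case True
  then show ?thesis using that[of 1] by simp
next
  case False
  then show ?thesis using that[of "a / of_real (cmod a)"] by (simp add: norm_divide)
qed

text \<open>The quotient rule produces the numerator a - (1 + |a|^2 - |b|^2) w + cnj(a) w^2. Since
  |b| = 1 - |a|, the middle coefficient is 2|a|, and the numerator is \<open>a\<close> times a
  perfect square.\<close>

lemma model_z_derivative:
  fixes a b \<mu> z w :: complex
  assumes ab: "cmod a + cmod b = 1" and a: "a = of_real (cmod a) * \<alpha>" "cmod \<alpha> = 1"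
    and D: "1 - cnj b * z - cnj a * w \<noteq> 0"
  shows "((\<lambda>z. \<mu> * ((a * z + b * w - z * w) / (1 - cnj b * z - cnj a * w))) has_field_derivative
           \<mu> * (a * (1 - cnj \<alpha> * w)\<^sup>2 / (1 - cnj b * z - cnj a * w)\<^sup>2)) (at z)"
proof -
  define t where "t = cmod a"
  have \<alpha>: "\<alpha> * cnj \<alpha> = 1"
    using a(2) by (simp flip: complex_norm_square)
  have at: "a = of_real t * \<alpha>"
    using a(1) by (simp add: t_def)
  have ca: "cnj a = of_real t * cnj \<alpha>"
    by (simp add: at)
  have "cmod b = 1 - t"
    using ab by (simp add: t_def)
  then have bb: "b * cnj b = (1 - of_real t)\<^sup>2"
    by (simp flip: complex_norm_square)
  have "(a - w) * (1 - cnj b * z - cnj a * w) - (a * z + b * w - z * w) * (- cnj b)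
      = a * (1 - cnj \<alpha> * w)\<^sup>2"
    using \<alpha> bb unfolding ca unfolding at by algebra
  then have "((\<lambda>z. (a * z + b * w - z * w) / (1 - cnj b * z - cnj a * w)) has_field_derivative
      a * (1 - cnj \<alpha> * w)\<^sup>2 / (1 - cnj b * z - cnj a * w)\<^sup>2) (at z)"
    using D by (auto intro!: derivative_eq_intros simp: power2_eq_square)
  then show ?thesis
    by (rule DERIV_cmult)
qed

lemma model_extremal:
  fixes f :: "complex \<times> complex \<Rightarrow> complex" and \<mu> a b :: complex
  assumes \<mu>: "cmod \<mu> = 1" and ab: "cmod a + cmod b = 1"
    and f: "\<And>z w. z \<in> \<D> \<Longrightarrow> w \<in> \<D> \<Longrightarrow>
              f (z, w) = \<mu> * ((a * z + b * w - z * w) / (1 - cnj b * z - cnj a * w))"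
  shows "everywhere_infinitesimally_extremal f"
  unfolding everywhere_infinitesimally_extremal_def
proof clarify
  fix z w :: complex assume z: "z \<in> \<D>" and w: "w \<in> \<D>"
  obtain \<alpha> where \<alpha>: "cmod \<alpha> = 1" "a = of_real (cmod a) * \<alpha>" by (rule polar_form)
  obtain \<beta> where \<beta>: "cmod \<beta> = 1" "b = of_real (cmod b) * \<beta>" by (rule polar_form)
  define t where "t = cmod a"
  have bt: "cmod b = 1 - t"
    using ab by (simp add: t_def)
  define D where "D = 1 - cnj b * z - cnj a * w"
  define N where "N = a * z + b * w - z * w"
  have D: "D \<noteq> 0"
    unfolding D_def using denominator_nonzero[OF ab] z w by simp
  have "((\<lambda>z. f (z, w)) has_field_derivative \<mu> * (a * (1 - cnj \<alpha> * w)\<^sup>2 / D\<^sup>2)) (at z)"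
    using model_z_derivative[OF ab \<alpha>(2,1) D[unfolded D_def], of \<mu>, folded D_def]
    by (rule has_field_derivative_transform_within_open[where S=\<D>]) (use z w f in auto)
  then have pz: "cmod (partial_z f (z, w)) = t * (cmod (1 - cnj \<alpha> * w))\<^sup>2 / (cmod D)\<^sup>2"
    using \<mu> by (simp add: partial_z_def DERIV_imp_deriv norm_mult norm_divide norm_power t_def)
  \<comment> \<open>The derivative in \<open>w\<close> comes from the same lemma with the pairs
    \<open>a\<close>, \<open>z\<close> and \<open>b\<close>, \<open>w\<close> exchanged.\<close>
  have ba: "cmod b + cmod a = 1" and D': "1 - cnj a * w - cnj b * z \<noteq> 0"
    using ab D by (auto simp: D_def algebra_simps)
  have "1 - cnj a * w - cnj b * z = D"
    by (simp add: D_def)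
  with model_z_derivative[OF ba \<beta>(2,1) D', of \<mu>]
  have "((\<lambda>w. \<mu> * ((b * w + a * z - w * z) / (1 - cnj a * w - cnj b * z))) has_field_derivative
      \<mu> * (b * (1 - cnj \<beta> * z)\<^sup>2 / D\<^sup>2)) (at w)"
    by simp
  then have "((\<lambda>w. f (z, w)) has_field_derivative \<mu> * (b * (1 - cnj \<beta> * z)\<^sup>2 / D\<^sup>2)) (at w)"
    by (rule has_field_derivative_transform_within_open[where S=\<D>])
       (use z w f in \<open>auto simp: algebra_simps\<close>)
  then have pw: "cmod (partial_w f (z, w)) = (1 - t) * (cmod (1 - cnj \<beta> * z))\<^sup>2 / (cmod D)\<^sup>2"
    using \<mu> by (simp add: partial_w_def DERIV_imp_deriv norm_mult norm_divide norm_power bt)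
  \<comment> \<open>The denominator contains \<open>cnj b * z\<close> and \<open>cnj a * w\<close>,
    so the phase of \<open>b\<close> is absorbed into \<open>z\<close> and that of \<open>a\<close>
    into \<open>w\<close>; the numerator then changes only by the unimodular factor
    \<open>\<alpha> * \<beta>\<close>.\<close>
  define u v where "u = cnj \<beta> * z" and "v = cnj \<alpha> * w"
  have norms: "cmod u = cmod z" "cmod v = cmod w"
    using \<alpha> \<beta> by (auto simp: u_def v_def norm_mult)
  have unit: "\<alpha> * cnj \<alpha> = 1" "\<beta> * cnj \<beta> = 1"
    using \<alpha>(1) \<beta>(1) by (simp_all flip: complex_norm_square)
  have zw: "z = \<beta> * u" "w = \<alpha> * v"
    using unit by (simp_all add: u_def v_def flip: mult.assoc)
  have at: "a = of_real t * \<alpha>" "b = of_real (1 - t) * \<beta>"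
    using \<alpha> \<beta> bt by (simp_all add: t_def)
  have Du: "D = 1 - of_real (1 - t) * u - of_real t * v"
    by (simp add: D_def at u_def v_def)
  have "N = \<alpha> * \<beta> * (of_real t * u + of_real (1 - t) * v - u * v)"
    unfolding N_def zw at by (simp add: algebra_simps)
  then have Nu: "cmod N = cmod (of_real t * u + of_real (1 - t) * v - u * v)"
    using \<alpha> \<beta> by (simp add: norm_mult)
  have "(1 - (cmod z)\<^sup>2) * cmod (partial_z f (z, w)) + (1 - (cmod w)\<^sup>2) * cmod (partial_w f (z, w))
     = ((1 - (cmod u)\<^sup>2) * (t * (cmod (1 - v))\<^sup>2) + (1 - (cmod v)\<^sup>2) * ((1 - t) * (cmod (1 - u))\<^sup>2)) / (cmod D)\<^sup>2"
    unfolding pz pw norms u_def[symmetric] v_def[symmetric] by (simp add: add_divide_distrib)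
  also have "\<dots> = ((cmod D)\<^sup>2 - (cmod N)\<^sup>2) / (cmod D)\<^sup>2"
    unfolding extremal_identity Du[symmetric] Nu ..
  also have "\<dots> = 1 - (cmod (f (z, w)))\<^sup>2"
    using D \<mu> f[OF z w]
    by (simp add: norm_mult norm_divide power_divide diff_divide_distrib flip: D_def N_def)
  finally show "(1 - (cmod z)\<^sup>2) * cmod (partial_z f (z, w)) + (1 - (cmod w)\<^sup>2) * cmod (partial_w f (z, w))
      = 1 - (cmod (f (z, w)))\<^sup>2" .
qed

section \<open>The characterization\<close>

lemma rotate_bidisk:
  fixes f :: "complex \<times> complex \<Rightarrow> complex"
  assumes f: "f holomorphic2_on \<D>\<^sup>2" and \<gamma>: "cmod \<gamma> = 1" and \<delta>: "cmod \<delta> = 1"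
  defines "F \<equiv> \<lambda>(z, w). f (\<gamma> * z, \<delta> * w)"
  shows "F holomorphic2_on \<D>\<^sup>2"
    and "\<And>z w. z \<in> \<D> \<Longrightarrow> w \<in> \<D> \<Longrightarrow> partial_z F (z, w) = \<gamma> * partial_z f (\<gamma> * z, \<delta> * w)"
    and "\<And>z w. z \<in> \<D> \<Longrightarrow> w \<in> \<D> \<Longrightarrow> partial_w F (z, w) = \<delta> * partial_w f (\<gamma> * z, \<delta> * w)"
proof -
  have in_disk: "\<gamma> * z \<in> \<D>" "\<delta> * z \<in> \<D>" if "z \<in> \<D>" for z
    using that \<gamma> \<delta> by (simp_all add: norm_mult)
  have op: "open (\<D>\<^sup>2)"
    by (simp add: open_Times)
  show "F holomorphic2_on \<D>\<^sup>2"
    unfolding holomorphic2_on_def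
  proof
    fix p assume p: "p \<in> \<D>\<^sup>2"
    then obtain z w where zw: "p = (z, w)" "z \<in> \<D>" "w \<in> \<D>" by blast
    have q: "(\<gamma> * fst p, \<delta> * snd p) \<in> \<D>\<^sup>2"
      using in_disk zw by simp
    then obtain A B where
      "(f has_derivative (\<lambda>(h, k). A * h + B * k)) (at (\<gamma> * fst p, \<delta> * snd p) within \<D>\<^sup>2)"
      using f unfolding holomorphic2_on_def by blast
    then have df: "(f has_derivative (\<lambda>(h, k). A * h + B * k)) (at (\<gamma> * fst p, \<delta> * snd p))"
      using at_within_open[OF q op] by simp
    have "((\<lambda>p. (\<gamma> * fst p, \<delta> * snd p)) has_derivative (\<lambda>h. (\<gamma> * fst h, \<delta> * snd h))) (at p within \<D>\<^sup>2)"
      by (auto intro!: derivative_eq_intros)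
    from has_derivative_compose[OF this df]
    have "((\<lambda>p. f (\<gamma> * fst p, \<delta> * snd p)) has_derivative (\<lambda>(h, k). (A * \<gamma>) * h + (B * \<delta>) * k)) (at p within \<D>\<^sup>2)"
      by (simp add: case_prod_unfold mult.assoc)
    then show "\<exists>A B. (F has_derivative (\<lambda>(h, k). A * h + B * k)) (at p within \<D>\<^sup>2)"
      unfolding F_def case_prod_unfold by blast
  qed
  fix z w :: complex assume z: "z \<in> \<D>" and w: "w \<in> \<D>"
  have "(\<lambda>\<zeta>. f (\<zeta>, \<delta> * w)) holomorphic_on \<D>"
    using in_disk[OF w] by (intro holomorphic2_on_compose[OF f] holomorphic_intros) auto
  then have "((\<lambda>\<zeta>. f (\<zeta>, \<delta> * w)) has_field_derivative partial_z f (\<gamma> * z, \<delta> * w)) (at (\<gamma> * z))"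
    using holomorphic_derivI in_disk[OF z] unfolding partial_z_def by fastforce
  from DERIV_imp_deriv[OF DERIV_chain2[where g = "(*) \<gamma>" and x = z, OF this DERIV_cmult_Id]]
  have "deriv (\<lambda>\<zeta>. f (\<gamma> * \<zeta>, \<delta> * w)) z = \<gamma> * partial_z f (\<gamma> * z, \<delta> * w)"
    by (simp only: mult.commute)
  then show "partial_z F (z, w) = \<gamma> * partial_z f (\<gamma> * z, \<delta> * w)"
    by (simp only: partial_z_def F_def case_prod_conv)
  have "(\<lambda>\<zeta>. f (\<gamma> * z, \<zeta>)) holomorphic_on \<D>"
    using in_disk[OF z] by (intro holomorphic2_on_compose[OF f] holomorphic_intros) auto
  then have "((\<lambda>\<zeta>. f (\<gamma> * z, \<zeta>)) has_field_derivative partial_w f (\<gamma> * z, \<delta> * w)) (at (\<delta> * w))"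
    using holomorphic_derivI in_disk[OF w] unfolding partial_w_def by fastforce
  from DERIV_imp_deriv[OF DERIV_chain2[where g = "(*) \<delta>" and x = w, OF this DERIV_cmult_Id]]
  have "deriv (\<lambda>\<zeta>. f (\<gamma> * z, \<delta> * \<zeta>)) w = \<delta> * partial_w f (\<gamma> * z, \<delta> * w)"
    by (simp only: mult.commute)
  then show "partial_w F (z, w) = \<delta> * partial_w f (\<gamma> * z, \<delta> * w)"
    by (simp only: partial_w_def F_def case_prod_conv)
qed

lemma extremal_imp_model:
  fixes f :: "complex \<times> complex \<Rightarrow> complex"
  assumes f: "f holomorphic2_on \<D>\<^sup>2" and fD: "f \<in> \<D>\<^sup>2 \<rightarrow> \<D>" and f0: "f (0, 0) = 0"
    and ext: "everywhere_infinitesimally_extremal f"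
  shows "\<exists>\<mu> a b :: complex. cmod \<mu> = 1 \<and> cmod a + cmod b = 1 \<and>
    (\<forall>z\<in>\<D>. \<forall>w\<in>\<D>. f (z, w) = \<mu> * ((a * z + b * w - z * w) / (1 - cnj b * z - cnj a * w)))"
proof -
  define p q where "p = partial_z f (0, 0)" and "q = partial_w f (0, 0)"
  have ext': "(1 - (cmod z)\<^sup>2) * cmod (partial_z f (z, w)) + (1 - (cmod w)\<^sup>2) * cmod (partial_w f (z, w))
          = 1 - (cmod (f (z, w)))\<^sup>2" if "z \<in> \<D>" "w \<in> \<D>" for z w
    using ext that unfolding everywhere_infinitesimally_extremal_def by blast
  have pq: "cmod p + cmod q = 1"
    using ext'[of 0 0] f0 by (simp add: p_def q_def)
  show ?thesis
  proof (cases "p = 0 \<or> q = 0")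
    case True
    have lin: "f (z, w) = p * z + q * w" if "z \<in> \<D>" "w \<in> \<D>" for z w
      by (rule extremal_degenerate[OF f fD f0 p_def[symmetric] q_def[symmetric] pq True that])
    \<comment> \<open>The linear functions are models in disguise: if \<open>q = 0\<close>, then
      \<open>p * z - z * w = p * z * (1 - cnj p * w)\<close> because \<open>p * cnj p = 1\<close>,
      and symmetrically if \<open>p = 0\<close>.\<close>
    have "f (z, w) = 1 * ((p * z + q * w - z * w) / (1 - cnj q * z - cnj p * w))"
      if zw: "z \<in> \<D>" "w \<in> \<D>" for z w
    proof -
      have D: "1 - cnj q * z - cnj p * w \<noteq> 0"
        using denominator_nonzero[OF pq] zw by simp
      have "p * cnj p = 1 \<and> q = 0 \<or> q * cnj q = 1 \<and> p = 0"
        using True pq by (auto simp flip: complex_norm_square)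
      then have "p * z + q * w - z * w = (p * z + q * w) * (1 - cnj q * z - cnj p * w)"
        by (elim disjE conjE) (simp, algebra)+
      then show ?thesis
        using D lin[OF zw] by simp
    qed
    then show ?thesis
      using pq by (intro exI[of _ 1] exI[of _ p] exI[of _ q]) auto
  next
    case False
    define t where "t = cmod p"
    have qt: "cmod q = 1 - t" and t: "0 < t" "t < 1"
      using False pq by (auto simp: t_def) (smt (verit) zero_less_norm_iff)
    obtain \<alpha> where \<alpha>: "cmod \<alpha> = 1" "p = of_real (cmod p) * \<alpha>" by (rule polar_form)
    obtain \<beta> where \<beta>: "cmod \<beta> = 1" "q = of_real (cmod q) * \<beta>" by (rule polar_form)
    have unit: "\<alpha> * cnj \<alpha> = 1" "\<beta> * cnj \<beta> = 1"
      using \<alpha>(1) \<beta>(1) by (simp_all flip: complex_norm_square)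
    \<comment> \<open>Rotating by the conjugate phases turns the first derivatives at the origin
      into the positive reals \<open>t\<close> and \<open>1 - t\<close>.\<close>
    define F where "F = (\<lambda>(z, w). f (cnj \<alpha> * z, cnj \<beta> * w))"
    have cn: "cmod (cnj \<alpha>) = 1" "cmod (cnj \<beta>) = 1"
      using \<alpha> \<beta> by auto
    note rot = rotate_bidisk[OF f cn, folded F_def]
    have FD: "F \<in> \<D>\<^sup>2 \<rightarrow> \<D>"
    proof
      fix x assume "x \<in> \<D>\<^sup>2"
      then have "(cnj \<alpha> * fst x, cnj \<beta> * snd x) \<in> \<D>\<^sup>2"
        using \<alpha> \<beta> by (auto simp: norm_mult)
      then show "F x \<in> \<D>"
        using funcset_mem[OF fD] by (simp add: F_def case_prod_unfold)
    qed
    have F0: "F (0, 0) = 0"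
      by (simp add: F_def f0)
    have Fz: "partial_z F (0, 0) = of_real t"
      using rot(2)[of 0 0] \<alpha>(2) unit(1) by (simp add: p_def[symmetric] t_def) (metis mult.assoc mult.commute mult.right_neutral)
    have Fw: "partial_w F (0, 0) = of_real (1 - t)"
      using rot(3)[of 0 0] \<beta>(2) unit(2) unfolding qt by (simp add: q_def[symmetric]) (metis mult.assoc mult.commute mult.right_neutral)
    have Fext: "(1 - (cmod z)\<^sup>2) * cmod (partial_z F (z, 0)) + cmod (partial_w F (z, 0)) = 1 - (cmod (F (z, 0)))\<^sup>2"
      if "z \<in> \<D>" for z
      using ext'[of "cnj \<alpha> * z" 0] that rot(2,3)[of z 0] \<alpha>(1) \<beta>(1) by (simp add: F_def norm_mult)
    obtain \<Theta> where \<Theta>: "cmod \<Theta> = 1"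
      and F: "\<And>z w :: complex. z \<in> \<D> \<Longrightarrow> w \<in> \<D> \<Longrightarrow>
        F (z, w) * (1 - \<Theta> * (of_real (1 - t) * z + of_real t * w))
          = of_real t * z + of_real (1 - t) * w - \<Theta> * z * w"
      using extremal_normalized[OF rot(1) FD F0 t Fz Fw Fext] by blast
    have \<Theta>c: "\<Theta> * cnj \<Theta> = 1"
      using \<Theta> by (simp flip: complex_norm_square)
    \<comment> \<open>Undoing the rotation gives a numerator with zw-coefficient
      \<open>- \<Theta> * \<alpha> * \<beta>\<close>. Normalizing it to -1 yields
      \<open>\<mu>\<close>, and dividing the linear coefficients \<open>t * \<alpha>\<close> and
      \<open>(1 - t) * \<beta>\<close> by \<open>\<mu>\<close> yields \<open>a\<close> and
      \<open>b\<close>, whose conjugates match the denominator.\<close>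
    define \<mu> a b where "\<mu> = \<Theta> * \<alpha> * \<beta>" and "a = of_real t * cnj \<Theta> * cnj \<beta>"
      and "b = of_real (1 - t) * cnj \<Theta> * cnj \<alpha>"
    have \<mu>: "cmod \<mu> = 1"
      using \<Theta> \<alpha> \<beta> by (simp add: \<mu>_def norm_mult)
    have "cmod a = t" "cmod b = 1 - t"
      using \<Theta> \<alpha> \<beta> t by (simp_all add: a_def b_def norm_mult del: of_real_diff)
    then have ab: "cmod a + cmod b = 1"
      by simp
    have "f (z, w) = \<mu> * ((a * z + b * w - z * w) / (1 - cnj b * z - cnj a * w))"
      if z: "z \<in> \<D>" and w: "w \<in> \<D>" for z w
    proof -
      have D: "1 - cnj b * z - cnj a * w \<noteq> 0"
        using denominator_nonzero[OF ab] z w by simp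
      have "cnj \<alpha> * (\<alpha> * z) = z" "cnj \<beta> * (\<beta> * w) = w"
        using unit by algebra+
      then have "F (\<alpha> * z, \<beta> * w) = f (z, w)"
        by (simp only: F_def case_prod_conv)
      moreover have "\<alpha> * z \<in> \<D>" "\<beta> * w \<in> \<D>"
        using z w \<alpha> \<beta> by (simp_all add: norm_mult)
      ultimately have "f (z, w) * (1 - \<Theta> * (of_real (1 - t) * (\<alpha> * z) + of_real t * (\<beta> * w)))
          = of_real t * (\<alpha> * z) + of_real (1 - t) * (\<beta> * w) - \<Theta> * (\<alpha> * z) * (\<beta> * w)"
        using F by metis
      moreover have "1 - \<Theta> * (of_real (1 - t) * (\<alpha> * z) + of_real t * (\<beta> * w)) = 1 - cnj b * z - cnj a * w"
        by (simp add: a_def b_def algebra_simps)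
      moreover have "of_real t * (\<alpha> * z) + of_real (1 - t) * (\<beta> * w) - \<Theta> * (\<alpha> * z) * (\<beta> * w)
          = \<mu> * (a * z + b * w - z * w)"
        unfolding \<mu>_def a_def b_def using \<Theta>c unit by algebra
      ultimately have "f (z, w) * (1 - cnj b * z - cnj a * w) = \<mu> * (a * z + b * w - z * w)"
        by (simp only:)
      then show ?thesis
        using D by (simp add: field_simps)
    qed
    then show ?thesis
      using \<mu> ab by blast
  qed
qed

theorem mainTheorem4:
  fixes f :: "complex \<times> complex \<Rightarrow> complex"
  assumes "f holomorphic2_on \<D>\<^sup>2"
    and "f \<in> \<D>\<^sup>2 \<rightarrow> \<D>"
    and "f (0, 0) = 0"
  shows "everywhere_infinitesimally_extremal f \<longleftrightarrow>
    (\<exists>\<mu> a b :: complex. cmod \<mu> = 1 \<and> cmod a + cmod b = 1 \<and>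
       (\<forall>(z, w) \<in> \<D>\<^sup>2. f (z, w) = \<mu> * ((a * z + b * w - z * w) / (1 - cnj b * z - cnj a * w))))"
    (is "_ \<longleftrightarrow> (\<exists>\<mu> a b. ?model \<mu> a b)")
proof
  assume "everywhere_infinitesimally_extremal f"
  then show "\<exists>\<mu> a b. ?model \<mu> a b"
    using extremal_imp_model[OF assms] by blast
next
  assume "\<exists>\<mu> a b. ?model \<mu> a b"
  then show "everywhere_infinitesimally_extremal f"
    using model_extremal by blast
qed

end
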